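(* Let $\Omega=(a,b)$ be a nonempty bounded open interval, $\beta\in(0,2)$, $\lambda\ge 0$. For every $f\in H^{-\beta/2}(\Omega)$ the weak formulation: find $p\in\widetilde H_0^{\beta/2}(\Omega)$ such that $$B(p,v)=\langle f,v\rangle\qquad\text{for all } v\in\widetilde H_0^{\beta/2}(\Omega),$$ is well-posed: it has a unique solution $p$, and there is a constant $C>0$, independent of $f$ and $p$, such that $$\|p\|_{H^{\beta/2}(\mathbb{R})}\le C\,\|f\|_{H^{-\beta/2}(\Omega)}.$$
   Context: Functions are real-valued. For $s\in(0,1)$ and an open set $E\subset\mathbb{R}$, $H^s(E)$ is the Sobolev space with norm $\|w\|_{H^s(E)}=(\|w\|_{L^2(E)}^2+|w|_{H^s(E)}^2)^{1/2}$, where $|w|_{H^s(E)}^2=\int_E\int_E\frac{|w(x)-w(y)|^2}{|x-y|^{1+2s}}\,dx\,dy$. $H_0^s(\Omega)$ is the closure of $C_0^\infty(\Omega)$ in $H^s(\Omega)$, and $H^{-s}(\Omega)$ is the dual space of $H_0^s(\Omega)$. $\widetilde H_0^s(\Omega)$ is the closure in $H^s(\mathbb{R})$ of the space of infinitely differentiable functions on $\mathbb{R}$ with compact support contained in $\Omega$ (restrictions to $\Omega$ of its elements lie in $H_0^s(\Omega)$). $\langle f,v\rangle$ denotes the duality pairing, formally $\int_\Omega f(x)v(x)\,dx$. The bilinear form is $$B(p,v)=\frac{c_\beta}{2}\int_{\mathbb{R}}\int_{\mathbb{R}}\frac{(p(x)-p(y))(v(x)-v(y))}{e^{\lambda|x-y|}|x-y|^{1+\beta}}\,dy\,dx,$$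 with $c_\beta=\frac{\beta\,\Gamma(\frac{1+\beta}{2})}{2^{1-\beta}\pi^{1/2}\Gamma(1-\beta/2)}$ if $\lambda=0$ or $\beta=1$, and $c_\beta=\frac{\Gamma(1/2)}{2\pi^{1/2}|\Gamma(-\beta)|}$ if $\lambda>0$ and $\beta\neq1$. *)

theory Defs
  imports "HOL-Analysis.Analysis"
begin

text \<open>
  Elements of function spaces are represented by Borel functions (every Lebesgue class has such a
  representative) rather than by almost-everywhere classes.  A function on \<open>E \<subseteq> \<real>\<close> is represented
  by a total function on the reals whose values outside \<open>E\<close> are irrelevant, so a function on the
  reals also serves as its own restriction to \<open>E\<close>.
\<close>

definition sobolev_sq :: "real \<Rightarrow> real set \<Rightarrow> (real \<Rightarrow> real) \<Rightarrow> ennreal" where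
  "sobolev_sq s E w =
     (\<integral>\<^sup>+x\<in>E. ennreal ((w x)\<^sup>2) \<partial>lborel) +
     (\<integral>\<^sup>+x\<in>E. (\<integral>\<^sup>+y\<in>E. ennreal (\<bar>w x - w y\<bar>\<^sup>2 / \<bar>x - y\<bar> powr (1 + 2 * s)) \<partial>lborel) \<partial>lborel)"

definition sobolev_space :: "real \<Rightarrow> real set \<Rightarrow> (real \<Rightarrow> real) set" where
  "sobolev_space s E = {w. set_borel_measurable lborel E w \<and> sobolev_sq s E w < \<infinity>}"

definition sobolev_norm :: "real \<Rightarrow> real set \<Rightarrow> (real \<Rightarrow> real) \<Rightarrow> real" where
  "sobolev_norm s E w = sqrt (enn2real (sobolev_sq s E w))"

definition test_functions :: "real set \<Rightarrow> (real \<Rightarrow> real) set" where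
  "test_functions \<Omega> = {\<phi>. (\<forall>n. (deriv ^^ n) \<phi> differentiable_on UNIV) \<and>
                          compact (closure {x. \<phi> x \<noteq> 0}) \<and> closure {x. \<phi> x \<noteq> 0} \<subseteq> \<Omega>}"

text \<open>
  The closure is taken inside the Sobolev space; intersecting with \<open>sobolev_space s E\<close> ensures that
  the distance is a genuine one, as \<open>enn2real \<infinity> = 0\<close>.  For \<open>0 < s < 1\<close> every test function
  belongs to \<open>sobolev_space s E\<close>.
\<close>

definition sobolev_closure :: "real \<Rightarrow> real set \<Rightarrow> (real \<Rightarrow> real) set \<Rightarrow> (real \<Rightarrow> real) set" where
  "sobolev_closure s E S =
     {w \<in> sobolev_space s E.
        \<forall>\<epsilon>>0. \<exists>\<phi> \<in> S \<inter> sobolev_space s E. sobolev_norm s E (\<lambda>x. w x - \<phi> x) < \<epsilon>}"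

definition sobolev_zero :: "real \<Rightarrow> real set \<Rightarrow> (real \<Rightarrow> real) set" where
  "sobolev_zero s \<Omega> = sobolev_closure s \<Omega> (test_functions \<Omega>)"

definition sobolev_tilde_zero :: "real \<Rightarrow> real set \<Rightarrow> (real \<Rightarrow> real) set" where
  "sobolev_tilde_zero s \<Omega> = sobolev_closure s UNIV (test_functions \<Omega>)"

text \<open>
  An element of the dual space is a total functional of which only the values on \<open>sobolev_zero s \<Omega>\<close>
  matter.  Boundedness forces it to take equal values on functions that agree almost everywhere
  on \<open>\<Omega>\<close>.
\<close>

definition sobolev_dual :: "real \<Rightarrow> real set \<Rightarrow> ((real \<Rightarrow> real) \<Rightarrow> real) set" where
  "sobolev_dual s \<Omega> =
     {f. (\<forall>u\<in>sobolev_zero s \<Omega>. \<forall>v\<in>sobolev_zero s \<Omega>. f (\<lambda>x. u x + v x) = f u + f v) \<and>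
         (\<forall>c. \<forall>u\<in>sobolev_zero s \<Omega>. f (\<lambda>x. c * u x) = c * f u) \<and>
         (\<exists>K. \<forall>u\<in>sobolev_zero s \<Omega>. \<bar>f u\<bar> \<le> K * sobolev_norm s \<Omega> u)}"

definition sobolev_dual_norm :: "real \<Rightarrow> real set \<Rightarrow> ((real \<Rightarrow> real) \<Rightarrow> real) \<Rightarrow> real" where
  "sobolev_dual_norm s \<Omega> f = (SUP v\<in>{v \<in> sobolev_zero s \<Omega>. sobolev_norm s \<Omega> v \<le> 1}. \<bar>f v\<bar>)"

definition c_const :: "real \<Rightarrow> real \<Rightarrow> real" where
  "c_const \<beta> lam =
     (if lam = 0 \<or> \<beta> = 1
      then \<beta> * Gamma ((1 + \<beta>) / 2) / (2 powr (1 - \<beta>) * pi powr (1/2) * Gamma (1 - \<beta> / 2))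
      else Gamma (1/2) / (2 * pi powr (1/2) * \<bar>Gamma (- \<beta>)\<bar>))"

definition B_form :: "real \<Rightarrow> real \<Rightarrow> (real \<Rightarrow> real) \<Rightarrow> (real \<Rightarrow> real) \<Rightarrow> real" where
  "B_form \<beta> lam p v = c_const \<beta> lam / 2 *
     (\<integral>x. (\<integral>y. (p x - p y) * (v x - v y) / (exp (lam * \<bar>x - y\<bar>) * \<bar>x - y\<bar> powr (1 + \<beta>))
        \<partial>lborel) \<partial>lborel)"

text \<open>
  The pairing of \<open>f\<close> with \<open>v\<close> is \<open>f\<close> applied to the restriction of \<open>v\<close> to \<open>\<Omega>\<close>, which \<open>v\<close>
  itself represents; see \<open>sobolev_tilde_zero_subset\<close> below.
\<close>

definition weak_solution ::
  "real \<Rightarrow> real \<Rightarrow> real set \<Rightarrow> ((real \<Rightarrow> real) \<Rightarrow> real) \<Rightarrow> (real \<Rightarrow> real) \<Rightarrow> bool" where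
  "weak_solution \<beta> lam \<Omega> f p \<longleftrightarrow>
     p \<in> sobolev_tilde_zero (\<beta> / 2) \<Omega> \<and>
     (\<forall>v\<in>sobolev_tilde_zero (\<beta> / 2) \<Omega>. B_form \<beta> lam p v = f v)"

lemma sobolev_sq_mono: "E \<subseteq> F \<Longrightarrow> sobolev_sq s E w \<le> sobolev_sq s F w"
  unfolding sobolev_sq_def
  by (intro add_mono nn_integral_mono mult_mono) (auto simp: indicator_def)

lemma sobolev_space_mono:
  assumes "w \<in> sobolev_space s F" "E \<subseteq> F" "E \<in> sets borel"
  shows "w \<in> sobolev_space s E"
proof -
  have "set_borel_measurable lborel E w"
    using assms set_borel_measurable_subset[of lborel F w E]
    by (auto simp: sobolev_space_def)
  moreover have "sobolev_sq s E w < \<infinity>"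
    using assms sobolev_sq_mono[of E F s w] by (auto simp: sobolev_space_def)
  ultimately show ?thesis by (simp add: sobolev_space_def)
qed

lemma sobolev_sq_diff_finite:
  assumes "u \<in> sobolev_space s UNIV" "v \<in> sobolev_space s UNIV"
  shows "sobolev_sq s UNIV (\<lambda>x. u x - v x) < \<infinity>"
proof -
  have [measurable]: "u \<in> borel_measurable borel" "v \<in> borel_measurable borel"
    using assms by (auto simp: sobolev_space_def set_borel_measurable_def)
  have sq: "(a - b)\<^sup>2 \<le> 2 * a\<^sup>2 + 2 * b\<^sup>2" for a b :: real
    using zero_le_power2[of "a + b"] by (simp add: power2_eq_square algebra_simps)
  have 1: "ennreal ((u x - v x)\<^sup>2) \<le> 2 * ennreal ((u x)\<^sup>2) + 2 * ennreal ((v x)\<^sup>2)" for x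
    using sq[of "u x" "v x"]
    by (simp add: ennreal_mult[symmetric] ennreal_plus[symmetric] ennreal_leI
          flip: ennreal_numeral del: ennreal_plus)
  let ?k = "\<lambda>w x y. ennreal (\<bar>w x - w y\<bar>\<^sup>2 / \<bar>x - y\<bar> powr (1 + 2 * s))"
  have 2: "?k (\<lambda>x. u x - v x) x y \<le> 2 * ?k u x y + 2 * ?k v x y" for x y
  proof -
    have "\<bar>u x - v x - (u y - v y)\<bar>\<^sup>2 \<le> 2 * \<bar>u x - u y\<bar>\<^sup>2 + 2 * \<bar>v x - v y\<bar>\<^sup>2"
      using sq[of "u x - u y" "v x - v y"] by (simp add: algebra_simps)
    then have "\<bar>u x - v x - (u y - v y)\<bar>\<^sup>2 / \<bar>x - y\<bar> powr (1 + 2 * s) \<le>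
        2 * (\<bar>u x - u y\<bar>\<^sup>2 / \<bar>x - y\<bar> powr (1 + 2 * s)) + 2 * (\<bar>v x - v y\<bar>\<^sup>2 / \<bar>x - y\<bar> powr (1 + 2 * s))"
      by (simp add: divide_right_mono flip: add_divide_distrib)
    then show ?thesis
      by (simp add: ennreal_mult[symmetric] ennreal_plus[symmetric] ennreal_leI
          flip: ennreal_numeral del: ennreal_plus)
  qed
  have "sobolev_sq s UNIV (\<lambda>x. u x - v x) \<le>
      (\<integral>\<^sup>+x. 2 * ennreal ((u x)\<^sup>2) + 2 * ennreal ((v x)\<^sup>2) \<partial>lborel) +
      (\<integral>\<^sup>+x. (\<integral>\<^sup>+y. 2 * ?k u x y + 2 * ?k v x y \<partial>lborel) \<partial>lborel)"
    unfolding sobolev_sq_def using 1 2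
    by (simp, intro add_mono nn_integral_mono) auto
  also have "\<dots> = 2 * sobolev_sq s UNIV u + 2 * sobolev_sq s UNIV v"
    unfolding sobolev_sq_def
    by (simp add: nn_integral_add nn_integral_cmult distrib_left add_ac)
  also have "\<dots> < \<infinity>"
    using assms by (simp add: sobolev_space_def ennreal_mult_less_top)
  finally show ?thesis .
qed

lemma sobolev_tilde_zero_subset:
  assumes "open \<Omega>"
  shows "sobolev_tilde_zero s \<Omega> \<subseteq> sobolev_zero s \<Omega>"
proof
  fix w assume w: "w \<in> sobolev_tilde_zero s \<Omega>"
  have \<Omega>: "\<Omega> \<in> sets borel" using assms by simp
  have ws: "w \<in> sobolev_space s UNIV"
    using w by (auto simp: sobolev_tilde_zero_def sobolev_closure_def)
  have "\<exists>\<phi>\<in>test_functions \<Omega> \<inter> sobolev_space s \<Omega>. sobolev_norm s \<Omega> (\<lambda>x. w x - \<phi> x) < \<epsilon>"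
    if "\<epsilon> > 0" for \<epsilon>
  proof -
    obtain \<phi> where \<phi>: "\<phi> \<in> test_functions \<Omega>" "\<phi> \<in> sobolev_space s UNIV"
        "sobolev_norm s UNIV (\<lambda>x. w x - \<phi> x) < \<epsilon>"
      using w \<open>\<epsilon> > 0\<close> unfolding sobolev_tilde_zero_def sobolev_closure_def by blast
    have "sobolev_norm s \<Omega> (\<lambda>x. w x - \<phi> x) \<le> sobolev_norm s UNIV (\<lambda>x. w x - \<phi> x)"
      unfolding sobolev_norm_def
      using sobolev_sq_diff_finite[OF ws \<phi>(2)] sobolev_sq_mono[of \<Omega> UNIV]
      by (intro real_sqrt_le_mono enn2real_mono) auto
    then show ?thesis
      using \<phi> sobolev_space_mono[OF \<phi>(2) _ \<Omega>] by force
  qed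
  then show "w \<in> sobolev_zero s \<Omega>"
    using sobolev_space_mono[OF ws _ \<Omega>]
    by (auto simp: sobolev_zero_def sobolev_closure_def)
qed

end

theory Submission
  imports Defs
begin

text \<open>
  Write \<open>\<Omega> = (a, b)\<close> and let \<open>V\<close> be the space \<open>sobolev_tilde_zero (\<beta> / 2) \<Omega>\<close>.  The theorem is the
  Riesz representation theorem for the symmetric form \<open>B\<close> on \<open>V\<close>.  What has to be shown is that \<open>B\<close>
  is, modulo null sets, an inner product on \<open>V\<close> whose norm is equivalent to the Sobolev norm; existence, uniqueness
  and the a priori bound then follow formally.

  One side of the equivalence is trivial, because \<open>exp (- lam * r) \<le> 1\<close>.  The other side,
  coercivity (\<open>sobolev_tilde_zero_coercive\<close>), rests on two estimates.  Elements of \<open>V\<close> vanish almost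
  everywhere outside \<open>\<Omega>\<close>, so every \<open>x\<close> in \<open>\<Omega>\<close> interacts with an adjacent interval of length \<open>b - a\<close>
  on which the function is zero and where the kernel is bounded below; hence the energy controls the
  \<open>L\<^sup>2\<close> norm (\<open>mass_le_energy\<close>, a fractional Poincare inequality).  The tempering factor
  \<open>exp (- lam * r)\<close> is bounded below for \<open>r \<le> 1\<close>, while for \<open>r > 1\<close> the untempered kernel is
  integrable and the long-range part of the seminorm is already controlled by the \<open>L\<^sup>2\<close> norm
  (\<open>energy_0_le\<close>).

  The Riesz theorem is proved for an abstract form on a space of functions by minimising
  \<open>B v v - 2 * f v\<close> (\<open>riesz_representation_of_complete_form\<close>).  A minimising sequence may be chosen
  with geometrically decaying defect, so completeness is needed only for rapidly Cauchy sequences.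
  For those, almost everywhere convergence follows from summability, and Fatou's lemma bounds both
  parts of the Sobolev norm of the error (\<open>rapidly_cauchy_sobolev_limit\<close>).
\<close>

section \<open>Riesz representation by minimisation\<close>

text \<open>
  Every appeal to positivity in the Riesz argument has this form: it gives the Cauchy--Schwarz
  inequality when \<open>a\<close> is the square of a norm, and the approximate Euler--Lagrange equation when \<open>a\<close> is the defect of an
  almost minimiser.
\<close>

lemma quadratic_nonneg_imp_discriminant:
  fixes a b c :: real
  assumes nonneg: "\<And>t. 0 \<le> a + 2 * t * b + t\<^sup>2 * c" and c: "0 \<le> c"
  shows "b\<^sup>2 \<le> a * c"
proof (cases "c = 0")
  case True
  have "b = 0"
  proof (rule ccontr)
    assume "b \<noteq> 0"
    \<comment> \<open>The affine function \<open>a + 2 * t * b\<close> takes the value \<open>-1\<close> at this \<open>t\<close>.\<close>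
    then have "a + 2 * (- (a + 1) / (2 * b)) * b = -1"
      by (simp add: field_simps)
    with nonneg[of "- (a + 1) / (2 * b)"] True show False by simp
  qed
  with True show ?thesis by simp
next
  case False
  with c have "c > 0" by simp
  have "0 \<le> a + 2 * (- b / c) * b + (- b / c)\<^sup>2 * c" by (rule nonneg)
  also have "\<dots> = a - b\<^sup>2 / c"
    using \<open>c > 0\<close> by (simp add: field_simps power2_eq_square)
  finally show ?thesis
    using \<open>c > 0\<close> by (simp add: field_simps)
qed

text \<open>
  Almost minimisers of \<open>J v = B v v - 2 * f v\<close> form a Cauchy sequence by the parallelogram identity,
  and the limit of their Euler--Lagrange equations is the equation sought.  Stating the lemma for
  a set of functions with pointwise operations, and with completeness for the form itself, avoids
  passing to classes of functions modulo null sets: \<open>B\<close> may be degenerate on functions that vanish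
  almost everywhere.
\<close>

lemma riesz_representation_of_complete_form:
  fixes V :: "('a \<Rightarrow> real) set" and B :: "('a \<Rightarrow> real) \<Rightarrow> ('a \<Rightarrow> real) \<Rightarrow> real"
    and f :: "('a \<Rightarrow> real) \<Rightarrow> real"
  assumes ne: "V \<noteq> {}"
    and lin: "\<And>u v c. u \<in> V \<Longrightarrow> v \<in> V \<Longrightarrow> (\<lambda>x. u x + c * v x) \<in> V"
    and B_lin: "\<And>u v w c. u \<in> V \<Longrightarrow> v \<in> V \<Longrightarrow> w \<in> V \<Longrightarrow>
                  B (\<lambda>x. u x + c * v x) w = B u w + c * B v w"
    and B_sym: "\<And>u v. u \<in> V \<Longrightarrow> v \<in> V \<Longrightarrow> B u v = B v u"
    and B_nonneg: "\<And>v. v \<in> V \<Longrightarrow> 0 \<le> B v v"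
    and f_lin: "\<And>u v c. u \<in> V \<Longrightarrow> v \<in> V \<Longrightarrow> f (\<lambda>x. u x + c * v x) = f u + c * f v"
    and f_bdd: "\<And>v. v \<in> V \<Longrightarrow> (f v)\<^sup>2 \<le> K * B v v" and K: "0 \<le> K"
    and complete: "\<And>u :: nat \<Rightarrow> 'a \<Rightarrow> real. (\<And>n. u n \<in> V) \<Longrightarrow>
        (\<And>n m. n \<le> m \<Longrightarrow> B (\<lambda>x. u m x - u n x) (\<lambda>x. u m x - u n x) \<le> (1/4) ^ n) \<Longrightarrow>
        \<exists>w\<in>V. (\<lambda>n. B (\<lambda>x. u n x - w x) (\<lambda>x. u n x - w x)) \<longlonglongrightarrow> 0"
  shows "\<exists>p\<in>V. \<forall>v\<in>V. B p v = f v"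
proof -
  have diff: "(\<lambda>x. u x - v x) \<in> V" if "u \<in> V" "v \<in> V" for u v
    using lin[OF that, of "-1"] by simp
  have B_expand: "B (\<lambda>x. u x + t * v x) (\<lambda>x. u x + t * v x) = B u u + 2 * t * B u v + t\<^sup>2 * B v v"
    if "u \<in> V" "v \<in> V" for u v t
    using that lin[OF that, of t]
    by (simp add: B_lin B_sym[of _ "\<lambda>x. u x + t * v x"] B_sym[of v u] power2_eq_square algebra_simps)
  have cauchy_schwarz: "(B u v)\<^sup>2 \<le> B u u * B v v" if "u \<in> V" "v \<in> V" for u v
    using that B_nonneg[OF lin[OF that]]
    by (intro quadratic_nonneg_imp_discriminant B_nonneg) (simp_all add: B_expand)
  define J where "J = (\<lambda>v. B v v - 2 * f v)"
  have J_expand: "J (\<lambda>x. u x + t * v x) = J u + 2 * t * (B u v - f v) + t\<^sup>2 * B v v"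
    if "u \<in> V" "v \<in> V" for u v t
    using that by (simp add: J_def B_expand f_lin algebra_simps)
  have J_lower: "- K \<le> J v" if "v \<in> V" for v
  proof -
    \<comment> \<open>Boundedness of \<open>f\<close> and the inequality of arithmetic and geometric means give \<open>2 * f v \<le> K + B v v\<close>.\<close>
    have "(2 * f v)\<^sup>2 \<le> 4 * (K * B v v)"
      using f_bdd[OF that] by (simp add: power2_eq_square)
    also have "\<dots> \<le> (K + B v v)\<^sup>2"
      using zero_le_power2[of "K - B v v"] by (simp add: power2_eq_square algebra_simps)
    finally have "2 * f v \<le> K + B v v"
      by (rule power2_le_imp_le) (use K B_nonneg[OF that] in simp)
    then show ?thesis by (simp add: J_def)
  qed
  define d where "d = Inf (J ` V)"
  have bdd: "bdd_below (J ` V)"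
    using J_lower by (auto intro!: bdd_belowI)
  have d_le: "d \<le> J v" if "v \<in> V" for v
    unfolding d_def using that bdd by (intro cInf_lower) auto
  have "\<exists>v\<in>V. J v < d + (1/4) ^ Suc n" for n :: nat
  proof -
    have "Inf (J ` V) < d + (1/4) ^ Suc n" by (simp add: d_def)
    then obtain j where "j \<in> J ` V" "j < d + (1/4) ^ Suc n"
      using cInf_lessD[of "J ` V"] ne by blast
    then show ?thesis by auto
  qed
  then obtain u where u: "\<And>n. u n \<in> V" and Ju: "\<And>n. J (u n) < d + (1/4) ^ Suc n"
    by metis
  have "B (\<lambda>x. u m x - u n x) (\<lambda>x. u m x - u n x) \<le> (1/4) ^ n" if "n \<le> m" for n m
  proof -
    define e where "e = (\<lambda>x. u m x - u n x)"
    have e: "e \<in> V" unfolding e_def using u by (intro diff)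
    \<comment> \<open>The parallelogram identity at the midpoint of \<open>u n\<close> and \<open>u m\<close>, where the value is at
      least \<open>d\<close>.\<close>
    have "d \<le> J (u n) + (B (u n) e - f e) + B e e / 4"
      using d_le[OF lin[OF u e, of n "1/2"]] J_expand[OF u e, of n "1/2"]
      by (simp add: power2_eq_square)
    moreover have "J (u m) = J (u n) + 2 * (B (u n) e - f e) + B e e"
      using J_expand[OF u e, of n 1] by (simp add: e_def)
    moreover have "(1/4 :: real) ^ Suc m \<le> (1/4) ^ Suc n"
      using that by (intro power_decreasing) auto
    moreover have "b \<le> 4 * p"
      if "d \<le> j + g + b / 4" "k = j + 2 * g + b" "q \<le> p" "j < d + p" "k < d + q" for b g j k p q
      using that by linarith
    ultimately have "B e e \<le> 4 * (1/4) ^ Suc n"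
      using Ju[of n] Ju[of m] by blast
    also have "\<dots> = (1/4) ^ n" by simp
    finally show ?thesis by (simp add: e_def)
  qed
  then obtain w where w: "w \<in> V" and lim: "(\<lambda>n. B (\<lambda>x. u n x - w x) (\<lambda>x. u n x - w x)) \<longlonglongrightarrow> 0"
    using complete[of u] u by blast
  have "B w v = f v" if v: "v \<in> V" for v
  proof -
    \<comment> \<open>Perturbing \<open>u n\<close> along \<open>v\<close> cannot lower \<open>J\<close> by more than the defect \<open>(1/4) ^ Suc n\<close>.\<close>
    have le: "(B (u n) v - f v)\<^sup>2 \<le> (1/4) ^ Suc n * B v v" for n
    proof (rule quadratic_nonneg_imp_discriminant)
      show "0 \<le> (1/4) ^ Suc n + 2 * t * (B (u n) v - f v) + t\<^sup>2 * B v v" for t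
        using d_le[OF lin[OF u v, of n t]] Ju[of n] J_expand[OF u v, of n t] by simp
    qed (rule B_nonneg[OF v])
    have "(\<lambda>n. (1/4) ^ Suc n * B v v) \<longlonglongrightarrow> 0"
      by (intro tendsto_mult_left_zero LIMSEQ_Suc LIMSEQ_power_zero) simp
    then have "(\<lambda>n. (B (u n) v - f v)\<^sup>2) \<longlonglongrightarrow> 0"
      by (rule Lim_null_comparison[rotated]) (use le in simp)
    then have 1: "(\<lambda>n. B (u n) v - f v) \<longlonglongrightarrow> 0"
      by simp
    have "(\<lambda>n. B (\<lambda>x. u n x - w x) (\<lambda>x. u n x - w x) * B v v) \<longlonglongrightarrow> 0"
      using tendsto_mult_right[OF lim, of "B v v"] by simp
    then have "(\<lambda>n. (B (\<lambda>x. u n x - w x) v)\<^sup>2) \<longlonglongrightarrow> 0"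
      by (rule Lim_null_comparison[rotated]) (use cauchy_schwarz[OF diff[OF u w] v] in simp)
    then have 2: "(\<lambda>n. B (\<lambda>x. u n x - w x) v) \<longlonglongrightarrow> 0"
      by simp
    have "B (\<lambda>x. u n x - w x) v = B (u n) v - B w v" for n
      using B_lin[OF u w v, of n "-1"] by simp
    then have "(\<lambda>n. B w v - f v) \<longlonglongrightarrow> 0"
      using tendsto_diff[OF 1 2] by simp
    then show ?thesis
      by (simp add: LIMSEQ_const_iff)
  qed
  with w show ?thesis by blast
qed

section \<open>The energy as an integral over the plane\<close>

text \<open>
  Only \<open>Gamma (- \<beta>)\<close> needs care: \<open>Gamma\<close> has no real zeros but takes the default value \<open>0\<close> at its
  poles, and \<open>- 1\<close> is the only pole in the range of \<open>- \<beta>\<close>.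
\<close>

lemma c_const_pos:
  assumes "0 < \<beta>" "\<beta> < 2"
  shows "0 < c_const \<beta> lam"
proof -
  have "- \<beta> \<notin> \<int>\<^sub>\<le>\<^sub>0" if "\<beta> \<noteq> 1"
  proof
    assume "- \<beta> \<in> \<int>\<^sub>\<le>\<^sub>0"
    then obtain n where "- \<beta> = - real n" by (elim nonpos_Ints_cases') 
    then have "\<beta> = real n" by simp
    with assms that have "n < 2" "n \<noteq> 0" "n \<noteq> 1" by auto
    then show False by simp
  qed
  then have "Gamma (- \<beta>) \<noteq> 0" if "\<beta> \<noteq> 1"
    using that by (auto simp: Gamma_eq_zero_iff)
  then show ?thesis
    using assms by (auto simp: c_const_def intro!: divide_pos_pos mult_pos_pos Gamma_real_pos)
qed

text \<open>
  The integrand of \<open>B_form\<close> as a function on the plane, so that integrability and Fubini's theorem can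
  be applied to it.  For \<open>lam = 0\<close> and \<open>p = v\<close> it is the integrand of the Gagliardo seminorm of order
  \<open>\<beta> / 2\<close>; on the diagonal it is \<open>0\<close>.
\<close>

definition energy_density :: "real \<Rightarrow> real \<Rightarrow> (real \<Rightarrow> real) \<Rightarrow> (real \<Rightarrow> real) \<Rightarrow> real \<times> real \<Rightarrow> real" where
  "energy_density \<beta> lam p v z =
     (p (fst z) - p (snd z)) * (v (fst z) - v (snd z)) /
     (exp (lam * \<bar>fst z - snd z\<bar>) * \<bar>fst z - snd z\<bar> powr (1 + \<beta>))"

definition energy :: "real \<Rightarrow> real \<Rightarrow> (real \<Rightarrow> real) \<Rightarrow> ennreal" where
  "energy \<beta> lam w = (\<integral>\<^sup>+z. ennreal (energy_density \<beta> lam w w z) \<partial>(lborel \<Otimes>\<^sub>M lborel))"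

definition mass :: "(real \<Rightarrow> real) \<Rightarrow> ennreal" where
  "mass w = (\<integral>\<^sup>+x. ennreal ((w x)\<^sup>2) \<partial>lborel)"

lemma energy_density_measurable [measurable]:
  assumes [measurable]: "p \<in> borel_measurable borel" "v \<in> borel_measurable borel"
  shows "energy_density \<beta> lam p v \<in> borel_measurable (lborel \<Otimes>\<^sub>M lborel)"
  unfolding energy_density_def by measurable

lemma energy_density_self_nonneg [simp]: "0 \<le> energy_density \<beta> lam w w z"
  by (simp add: energy_density_def)

lemma sobolev_sq_eq_mass_plus_energy:
  assumes [measurable]: "w \<in> borel_measurable borel"
  shows "sobolev_sq (\<beta> / 2) UNIV w = mass w + energy \<beta> 0 w"
proof -
  have "energy \<beta> 0 w =
      (\<integral>\<^sup>+x. (\<integral>\<^sup>+y. ennreal (energy_density \<beta> 0 w w (x, y)) \<partial>lborel) \<partial>lborel)"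
    unfolding energy_def by (subst lborel.nn_integral_fst[symmetric]) auto
  then show ?thesis
    by (simp add: sobolev_sq_def mass_def energy_density_def power2_eq_square abs_mult_self_eq)
qed

lemma energy_le_energy_0:
  assumes [measurable]: "w \<in> borel_measurable borel" and "0 \<le> lam"
  shows "energy \<beta> lam w \<le> energy \<beta> 0 w"
  unfolding energy_def
proof (intro nn_integral_mono ennreal_leI)
  fix z :: "real \<times> real"
  define r where "r = \<bar>fst z - snd z\<bar>"
  have "r powr (1 + \<beta>) \<le> exp (lam * r) * r powr (1 + \<beta>)"
    using \<open>0 \<le> lam\<close> mult_right_mono[of 1 "exp (lam * r)" "r powr (1 + \<beta>)"] by (simp add: r_def)
  then show "energy_density \<beta> lam w w z \<le> energy_density \<beta> 0 w w z"
    unfolding energy_density_def r_def[symmetric]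
    by (cases "r = 0") (auto intro!: divide_left_mono simp: mult_pos_pos r_def)
qed

text \<open>
  A substitute for the triangle inequality that stays with squares, and hence with integrals of
  nonnegative functions, where nothing has to be known to be finite.
\<close>

lemma energy_density_diff_le:
  "energy_density \<beta> lam (\<lambda>x. u x - v x) (\<lambda>x. u x - v x) z \<le>
     2 * energy_density \<beta> lam u u z + 2 * energy_density \<beta> lam v v z"
proof -
  have "(a - b) * (a - b) \<le> 2 * (a * a) + 2 * (b * b)" for a b :: real
    using zero_le_power2[of "a + b"] by (simp add: power2_eq_square algebra_simps)
  then have "(a - b) * (a - b) / r \<le> 2 * (a * a / r) + 2 * (b * b / r)" if "0 \<le> r" for a b r :: real
    using divide_right_mono[OF _ that] by (simp add: add_divide_distrib[symmetric])
  from this[of "exp (lam * \<bar>fst z - snd z\<bar>) * \<bar>fst z - snd z\<bar> powr (1 + \<beta>)"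
      "u (fst z) - u (snd z)" "v (fst z) - v (snd z)"]
  show ?thesis
    unfolding energy_density_def by (simp add: algebra_simps)
qed

lemma sobolev_sq_diff_le:
  assumes [measurable]: "u \<in> borel_measurable borel" "v \<in> borel_measurable borel"
  shows "sobolev_sq (\<beta> / 2) UNIV (\<lambda>x. u x - v x) \<le>
           2 * sobolev_sq (\<beta> / 2) UNIV u + 2 * sobolev_sq (\<beta> / 2) UNIV v"
proof -
  have "(a - b)\<^sup>2 \<le> 2 * a\<^sup>2 + 2 * b\<^sup>2" for a b :: real
    using zero_le_power2[of "a + b"] by (simp add: power2_eq_square algebra_simps)
  then have "mass (\<lambda>x. u x - v x) \<le> (\<integral>\<^sup>+x. ennreal (2 * (u x)\<^sup>2 + 2 * (v x)\<^sup>2) \<partial>lborel)"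
    unfolding mass_def by (intro nn_integral_mono ennreal_leI)
  also have "\<dots> = 2 * mass u + 2 * mass v"
    unfolding mass_def by (simp add: ennreal_plus ennreal_mult nn_integral_add nn_integral_cmult)
  finally have 1: "mass (\<lambda>x. u x - v x) \<le> 2 * mass u + 2 * mass v" .
  have "energy \<beta> 0 (\<lambda>x. u x - v x) \<le>
      (\<integral>\<^sup>+z. ennreal (2 * energy_density \<beta> 0 u u z + 2 * energy_density \<beta> 0 v v z) \<partial>(lborel \<Otimes>\<^sub>M lborel))"
    unfolding energy_def by (intro nn_integral_mono ennreal_leI energy_density_diff_le)
  also have "\<dots> = 2 * energy \<beta> 0 u + 2 * energy \<beta> 0 v"
    unfolding energy_def by (simp add: ennreal_plus ennreal_mult nn_integral_add nn_integral_cmult)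
  finally have 2: "energy \<beta> 0 (\<lambda>x. u x - v x) \<le> 2 * energy \<beta> 0 u + 2 * energy \<beta> 0 v" .
  show ?thesis
    using add_mono[OF 1 2] by (simp add: sobolev_sq_eq_mass_plus_energy distrib_left add_ac)
qed

lemma sobolev_sq_scale:
  assumes [measurable]: "u \<in> borel_measurable borel"
  shows "sobolev_sq (\<beta> / 2) UNIV (\<lambda>x. c * u x) = ennreal (c\<^sup>2) * sobolev_sq (\<beta> / 2) UNIV u"
proof -
  have 1: "mass (\<lambda>x. c * u x) = ennreal (c\<^sup>2) * mass u"
    unfolding mass_def by (simp add: power_mult_distrib ennreal_mult nn_integral_cmult)
  have "energy_density \<beta> 0 (\<lambda>x. c * u x) (\<lambda>x. c * u x) z = c\<^sup>2 * energy_density \<beta> 0 u u z" for z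
    by (simp add: energy_density_def power2_eq_square algebra_simps add_divide_distrib diff_divide_distrib)
  then have "energy \<beta> 0 (\<lambda>x. c * u x) = ennreal (c\<^sup>2) * energy \<beta> 0 u"
    unfolding energy_def by (simp add: ennreal_mult nn_integral_cmult)
  with 1 show ?thesis by (simp add: sobolev_sq_eq_mass_plus_energy distrib_left)
qed

text \<open>
  Finite energies make the mixed density integrable because \<open>\<bar>a * b\<bar> \<le> a\<^sup>2 + b\<^sup>2\<close>.  Without this,
  the iterated integral in \<open>B_form\<close> could not be treated as a bilinear expression.
\<close>

lemma energy_density_integrable:
  assumes [measurable]: "u \<in> borel_measurable borel" "v \<in> borel_measurable borel"
    and fin: "energy \<beta> lam u < \<infinity>" "energy \<beta> lam v < \<infinity>"
  shows "integrable (lborel \<Otimes>\<^sub>M lborel) (energy_density \<beta> lam u v)"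
proof (rule Bochner_Integration.integrable_bound)
  show "integrable (lborel \<Otimes>\<^sub>M lborel)
      (\<lambda>z. energy_density \<beta> lam u u z + energy_density \<beta> lam v v z)"
    using fin unfolding energy_def by (intro Bochner_Integration.integrable_add integrableI_nonneg) auto
  have "\<bar>a * b\<bar> \<le> a * a + b * b" for a b :: real
    using zero_le_power2[of "a + b"] zero_le_power2[of "a - b"] zero_le_square[of a] zero_le_square[of b]
    by (simp only: abs_le_iff power2_eq_square algebra_simps) linarith
  from this[of "u (fst z) - u (snd z)" "v (fst z) - v (snd z)" for z]
  have "norm (energy_density \<beta> lam u v z) \<le> norm (energy_density \<beta> lam u u z + energy_density \<beta> lam v v z)" for z
    by (simp add: energy_density_def abs_mult divide_right_mono flip: add_divide_distrib)
  then show "AE z in lborel \<Otimes>\<^sub>M lborel. norm (energy_density \<beta> lam u v z) \<le>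
      norm (energy_density \<beta> lam u u z + energy_density \<beta> lam v v z)" by simp
qed measurable

lemma B_form_eq_pair_integral:
  assumes "integrable (lborel \<Otimes>\<^sub>M lborel) (energy_density \<beta> lam u v)"
  shows "B_form \<beta> lam u v = c_const \<beta> lam / 2 * (\<integral>z. energy_density \<beta> lam u v z \<partial>(lborel \<Otimes>\<^sub>M lborel))"
  unfolding B_form_def lborel_pair.integral_fst'[OF assms, symmetric]
  by (simp add: energy_density_def)

lemma B_form_sym: "B_form \<beta> lam u v = B_form \<beta> lam v u"
  by (simp add: B_form_def mult.commute)

lemma B_form_linear:
  assumes "integrable (lborel \<Otimes>\<^sub>M lborel) (energy_density \<beta> lam u w)"
    and "integrable (lborel \<Otimes>\<^sub>M lborel) (energy_density \<beta> lam v w)"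
  shows "B_form \<beta> lam (\<lambda>x. u x + c * v x) w = B_form \<beta> lam u w + c * B_form \<beta> lam v w"
proof -
  have eq: "energy_density \<beta> lam (\<lambda>x. u x + c * v x) w =
      (\<lambda>z. energy_density \<beta> lam u w z + c * energy_density \<beta> lam v w z)"
    by (rule ext) (simp add: energy_density_def algebra_simps flip: add_divide_distrib diff_divide_distrib)
  have "integrable (lborel \<Otimes>\<^sub>M lborel) (energy_density \<beta> lam (\<lambda>x. u x + c * v x) w)"
    using assms by (simp add: eq)
  then have "B_form \<beta> lam (\<lambda>x. u x + c * v x) w = c_const \<beta> lam / 2 *
      (\<integral>z. energy_density \<beta> lam u w z + c * energy_density \<beta> lam v w z \<partial>(lborel \<Otimes>\<^sub>M lborel))"
    by (subst B_form_eq_pair_integral) (simp_all add: eq)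
  then show ?thesis
    using assms by (simp add: B_form_eq_pair_integral algebra_simps)
qed

lemma energy_eq_B_form:
  assumes "integrable (lborel \<Otimes>\<^sub>M lborel) (energy_density \<beta> lam w w)" and "0 < c_const \<beta> lam"
  shows "energy \<beta> lam w = ennreal (2 / c_const \<beta> lam * B_form \<beta> lam w w)"
  using assms(2) nn_integral_eq_integral[OF assms(1)]
  by (simp add: energy_def B_form_eq_pair_integral[OF assms(1)])

section \<open>Completeness of the Sobolev space\<close>

text \<open>
  Fatou's lemma in the form in which it passes Cauchy estimates to the limit.
\<close>

lemma nn_integral_le_of_AE_limit:
  fixes g :: "nat \<Rightarrow> 'a \<Rightarrow> real"
  assumes meas: "\<And>m. g m \<in> borel_measurable M"
    and lim: "AE x in M. (\<lambda>m. g m x) \<longlonglongrightarrow> h x"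
    and le: "\<And>m. N \<le> m \<Longrightarrow> (\<integral>\<^sup>+x. ennreal (g m x) \<partial>M) \<le> c"
  shows "(\<integral>\<^sup>+x. ennreal (h x) \<partial>M) \<le> c"
proof -
  have [measurable]: "\<And>m. g m \<in> borel_measurable M" by (fact meas)
  have "(\<integral>\<^sup>+x. ennreal (h x) \<partial>M) \<le> (\<integral>\<^sup>+x. liminf (\<lambda>m. ennreal (g m x)) \<partial>M)"
  proof (rule nn_integral_mono_AE, use lim in eventually_elim)
    fix x assume "(\<lambda>m. g m x) \<longlonglongrightarrow> h x"
    then have "(\<lambda>m. ennreal (g m x)) \<longlonglongrightarrow> ennreal (h x)" by (intro tendsto_intros)
    then show "ennreal (h x) \<le> liminf (\<lambda>m. ennreal (g m x))"
      by (simp add: lim_imp_Liminf)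
  qed
  also have "\<dots> \<le> liminf (\<lambda>m. (\<integral>\<^sup>+x. ennreal (g m x) \<partial>M))"
    by (intro nn_integral_liminf) measurable
  also have "\<dots> \<le> limsup (\<lambda>m. (\<integral>\<^sup>+x. ennreal (g m x) \<partial>M))"
    by (intro Liminf_le_Limsup) simp
  also have "\<dots> \<le> c"
    by (intro Limsup_bounded eventually_mono[OF eventually_ge_at_top[of N]] le)
  finally show ?thesis .
qed

text \<open>
  Transfers almost everywhere convergence on the line to the difference quotients, which depend on
  two points.
\<close>

lemma AE_lborel_imp_AE_pair:
  assumes "AE x in (lborel :: real measure). P x"
  shows "AE z in lborel \<Otimes>\<^sub>M lborel. P (fst z) \<and> P (snd z)"
proof -
  obtain N where N: "N \<in> null_sets lborel" "{x. \<not> P x} \<subseteq> N"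
    using assms by (auto simp: eventually_ae_filter)
  then have [measurable]: "N \<in> sets borel" by auto
  have N_ae: "AE x in lborel. x \<notin> N" using N by (rule_tac AE_not_in)
  have "AE x in lborel. AE y in lborel. x \<notin> N \<and> y \<notin> N"
    using N_ae by eventually_elim (use N_ae in auto)
  then have "AE z in lborel \<Otimes>\<^sub>M lborel. fst z \<notin> N \<and> snd z \<notin> N"
  proof (intro lborel_pair.AE_pair_measure)
    have "Measurable.pred (lborel \<Otimes>\<^sub>M lborel) (\<lambda>z. fst z \<notin> N \<and> snd z \<notin> N)"
      by measurable
    then show "{z \<in> space (lborel \<Otimes>\<^sub>M lborel). fst z \<notin> N \<and> snd z \<notin> N} \<in> sets (lborel \<Otimes>\<^sub>M lborel)"
      by (simp only: pred_def)
  qed simp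
  then show ?thesis
    by eventually_elim (use N in auto)
qed

text \<open>
  The Riesz--Fischer argument.  The increments have squared \<open>L\<^sup>2\<close> norm at most \<open>C * (1/4) ^ n\<close>, so even the
  series of their squares weighted by \<open>2 ^ n\<close> has a finite integral.  At almost every point the
  increments are therefore dominated by a geometric sequence of ratio \<open>1 / sqrt 2\<close>.
\<close>

lemma AE_convergent_of_rapidly_cauchy:
  fixes u :: "nat \<Rightarrow> real \<Rightarrow> real"
  assumes [measurable]: "\<And>n. u n \<in> borel_measurable borel"
    and C: "0 \<le> C" and cauchy: "\<And>n. mass (\<lambda>x. u (Suc n) x - u n x) \<le> ennreal (C * (1/4) ^ n)"
  shows "AE x in lborel. convergent (\<lambda>n. u n x)"
proof -
  define g where "g = (\<lambda>n x. 2 ^ n * (u (Suc n) x - u n x)\<^sup>2)"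
  have [measurable]: "g n \<in> borel_measurable borel" for n unfolding g_def by measurable
  have "(\<integral>\<^sup>+x. (\<Sum>n. ennreal (g n x)) \<partial>lborel) = (\<Sum>n. (\<integral>\<^sup>+x. ennreal (g n x) \<partial>lborel))"
    by (intro nn_integral_suminf) measurable
  also have "\<dots> \<le> (\<Sum>n. ennreal (C * (1/2) ^ n))"
  proof (intro suminf_le)
    fix n
    have "(\<integral>\<^sup>+x. ennreal (g n x) \<partial>lborel) = ennreal (2 ^ n) * mass (\<lambda>x. u (Suc n) x - u n x)"
      unfolding mass_def g_def by (subst nn_integral_cmult[symmetric]) (auto simp: ennreal_mult)
    also have "\<dots> \<le> ennreal (2 ^ n) * ennreal (C * (1/4) ^ n)"
      by (intro mult_left_mono cauchy) simp
    also have "\<dots> = ennreal (C * (1/2) ^ n)"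
      using C by (subst ennreal_mult[symmetric]) (auto simp: power_divide field_simps power_mult_distrib[symmetric])
    finally show "(\<integral>\<^sup>+x. ennreal (g n x) \<partial>lborel) \<le> ennreal (C * (1/2) ^ n)" .
  qed auto
  also have "\<dots> = ennreal (\<Sum>n. C * (1/2) ^ n)"
    using C by (intro suminf_ennreal2 summable_mult summable_geometric) auto
  finally have "(\<integral>\<^sup>+x. (\<Sum>n. ennreal (g n x)) \<partial>lborel) \<noteq> \<infinity>"
    by (auto simp: top_unique)
  then have "AE x in lborel. (\<Sum>n. ennreal (g n x)) \<noteq> \<infinity>"
    by (intro nn_integral_noteq_infinite) auto
  then show ?thesis
  proof eventually_elim
    fix x assume "(\<Sum>n. ennreal (g n x)) \<noteq> \<infinity>"
    then obtain S where S: "S \<ge> 0" "(\<Sum>n. ennreal (g n x)) = ennreal S"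
      by (cases "\<Sum>n. ennreal (g n x)") auto
    have bound: "norm (u (Suc n) x - u n x) \<le> sqrt S * (1 / sqrt 2) ^ n" for n
    proof -
      have "ennreal (g n x) \<le> (\<Sum>n. ennreal (g n x))"
        using sum_le_suminf[of "\<lambda>n. ennreal (g n x)" "{n}"] by simp
      then have "2 ^ n * (u (Suc n) x - u n x)\<^sup>2 \<le> S"
        using S by (simp add: g_def)
      then have "(u (Suc n) x - u n x)\<^sup>2 \<le> S / 2 ^ n"
        by (simp add: field_simps)
      then have "\<bar>u (Suc n) x - u n x\<bar> \<le> sqrt (S / 2 ^ n)"
        using real_sqrt_le_mono by fastforce
      also have "\<dots> = sqrt S * (1 / sqrt 2) ^ n"
        by (simp add: real_sqrt_divide real_sqrt_power power_divide)
      finally show ?thesis by simp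
    qed
    have "summable (\<lambda>n. sqrt S * (1 / sqrt 2) ^ n)"
      by (intro summable_mult summable_geometric) (simp add: real_sqrt_gt_1_iff)
    then have "summable (\<lambda>n. u (Suc n) x - u n x)"
      by (rule summable_comparison_test'[where N = 0]) (rule bound)
    then have "convergent (\<lambda>n. (\<Sum>k<n. u (Suc k) x - u k x))"
      by (simp add: summable_iff_convergent)
    then have "convergent (\<lambda>n. u n x - u 0 x)"
      by (simp only: sum_lessThan_telescope[of "\<lambda>n. u n x"])
    then show "convergent (\<lambda>n. u n x)"
      using convergent_add[OF _ convergent_const, of "\<lambda>n. u n x - u 0 x" "u 0 x"] by simp
  qed
qed

text \<open>
  The pointwise limit serves both parts of the norm: the squares and the squared difference quotients
  converge almost everywhere, and Fatou's lemma keeps the Cauchy bound for each.  The factor \<open>2\<close> comes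
  from treating the two parts separately.
\<close>

lemma rapidly_cauchy_sobolev_limit:
  fixes u :: "nat \<Rightarrow> real \<Rightarrow> real"
  assumes [measurable]: "\<And>n. u n \<in> borel_measurable borel"
    and C: "0 \<le> C"
    and cauchy: "\<And>n m. n \<le> m \<Longrightarrow>
      sobolev_sq (\<beta> / 2) UNIV (\<lambda>x. u m x - u n x) \<le> ennreal (C * (1/4) ^ n)"
  obtains w where "w \<in> borel_measurable borel"
    and "\<And>n. sobolev_sq (\<beta> / 2) UNIV (\<lambda>x. u n x - w x) \<le> ennreal (2 * C * (1/4) ^ n)"
proof -
  have cauchy': "mass (\<lambda>x. u m x - u n x) \<le> ennreal (C * (1/4) ^ n)"
    "energy \<beta> 0 (\<lambda>x. u m x - u n x) \<le> ennreal (C * (1/4) ^ n)" if "n \<le> m" for n m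
  proof -
    have "mass (\<lambda>x. u m x - u n x) + energy \<beta> 0 (\<lambda>x. u m x - u n x) \<le> ennreal (C * (1/4) ^ n)"
      using cauchy[OF that] by (subst (asm) sobolev_sq_eq_mass_plus_energy) auto
    then show "mass (\<lambda>x. u m x - u n x) \<le> ennreal (C * (1/4) ^ n)"
      "energy \<beta> 0 (\<lambda>x. u m x - u n x) \<le> ennreal (C * (1/4) ^ n)"
      by (auto intro: order_trans[rotated])
  qed
  define w where "w = (\<lambda>x. lim (\<lambda>n. u n x))"
  have w [measurable]: "w \<in> borel_measurable borel"
    unfolding w_def by measurable
  have "AE x in lborel. convergent (\<lambda>n. u n x)"
    using C cauchy' by (intro AE_convergent_of_rapidly_cauchy) auto
  then have ae: "AE x in lborel. (\<lambda>n. u n x) \<longlonglongrightarrow> w x"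
    unfolding w_def by eventually_elim (simp add: convergent_LIMSEQ_iff)
  have "sobolev_sq (\<beta> / 2) UNIV (\<lambda>x. u n x - w x) \<le> ennreal (2 * C * (1/4) ^ n)" for n
  proof -
    have "mass (\<lambda>x. u n x - w x) \<le> ennreal (C * (1/4) ^ n)"
      unfolding mass_def
    proof (rule nn_integral_le_of_AE_limit[where g = "\<lambda>m x. (u n x - u m x)\<^sup>2" and N = n])
      show "AE x in lborel. (\<lambda>m. (u n x - u m x)\<^sup>2) \<longlonglongrightarrow> (u n x - w x)\<^sup>2"
        using ae by eventually_elim (intro tendsto_intros)
      show "(\<integral>\<^sup>+x. ennreal ((u n x - u m x)\<^sup>2) \<partial>lborel) \<le> ennreal (C * (1/4) ^ n)" if "n \<le> m" for m
        using cauchy'(1)[OF that] by (simp add: mass_def power2_commute)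
    qed simp
    moreover have "energy \<beta> 0 (\<lambda>x. u n x - w x) \<le> ennreal (C * (1/4) ^ n)"
      unfolding energy_def
    proof (rule nn_integral_le_of_AE_limit[where N = n and
          g = "\<lambda>m. energy_density \<beta> 0 (\<lambda>x. u n x - u m x) (\<lambda>x. u n x - u m x)"])
      show "AE z in lborel \<Otimes>\<^sub>M lborel.
          (\<lambda>m. energy_density \<beta> 0 (\<lambda>x. u n x - u m x) (\<lambda>x. u n x - u m x) z)
             \<longlonglongrightarrow> energy_density \<beta> 0 (\<lambda>x. u n x - w x) (\<lambda>x. u n x - w x) z"
        using AE_lborel_imp_AE_pair[OF ae]
      proof eventually_elim
        case (elim z)
        then have "(\<lambda>m. u m (fst z)) \<longlonglongrightarrow> w (fst z)" "(\<lambda>m. u m (snd z)) \<longlonglongrightarrow> w (snd z)"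
          by auto
        then show ?case
          unfolding energy_density_def divide_inverse by (intro tendsto_mult tendsto_diff tendsto_const)
      qed
      have "energy_density \<beta> 0 (\<lambda>x. u n x - u m x) (\<lambda>x. u n x - u m x) =
          energy_density \<beta> 0 (\<lambda>x. u m x - u n x) (\<lambda>x. u m x - u n x)" for m
        by (rule ext) (simp add: energy_density_def algebra_simps)
      then show "(\<integral>\<^sup>+z. ennreal (energy_density \<beta> 0 (\<lambda>x. u n x - u m x) (\<lambda>x. u n x - u m x) z)
          \<partial>(lborel \<Otimes>\<^sub>M lborel)) \<le> ennreal (C * (1/4) ^ n)" if "n \<le> m" for m
        using cauchy'(2)[OF that] by (simp add: energy_def)
    qed measurable
    ultimately have "sobolev_sq (\<beta> / 2) UNIV (\<lambda>x. u n x - w x) \<le>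
        ennreal (C * (1/4) ^ n) + ennreal (C * (1/4) ^ n)"
      by (subst sobolev_sq_eq_mass_plus_energy) (auto intro: add_mono)
    also have "\<dots> = ennreal (2 * C * (1/4) ^ n)"
      using C by (simp flip: ennreal_plus)
    finally show ?thesis .
  qed
  with w show thesis by (rule that)
qed

section \<open>The closure of the test functions\<close>

text \<open>
  The operator \<open>deriv\<close> is total, with an unspecified value where a function is not differentiable, so
  the iterates are shown to be linear on functions that are differentiable to every order.
\<close>

lemma iterated_deriv_linear:
  assumes "\<And>n. (deriv ^^ n) u differentiable_on (UNIV :: real set)"
    and "\<And>n. (deriv ^^ n) v differentiable_on (UNIV :: real set)"
  shows "(deriv ^^ n) (\<lambda>x. u x + c * v x) = (\<lambda>x. (deriv ^^ n) u x + c * (deriv ^^ n) v x :: real)"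
proof (induction n)
  case (Suc n)
  have "(deriv ^^ n) u differentiable at x" "(deriv ^^ n) v differentiable at x" for x
    using assms by (auto simp: differentiable_on_def)
  then have "DERIV ((deriv ^^ n) u) x :> deriv ((deriv ^^ n) u) x"
    "DERIV ((deriv ^^ n) v) x :> deriv ((deriv ^^ n) v) x" for x
    by (auto simp: DERIV_deriv_iff_real_differentiable)
  then have "DERIV (\<lambda>x. (deriv ^^ n) u x + c * (deriv ^^ n) v x) x :>
      deriv ((deriv ^^ n) u) x + c * deriv ((deriv ^^ n) v) x" for x
    by (intro DERIV_add DERIV_cmult)
  then show ?case
    by (auto simp: Suc.IH DERIV_imp_deriv)
qed simp

lemma test_functions_linear:
  assumes u: "u \<in> test_functions \<Omega>" and v: "v \<in> test_functions \<Omega>"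
  shows "(\<lambda>x. u x + c * v x) \<in> test_functions \<Omega>"
proof -
  have du: "\<And>n. (deriv ^^ n) u differentiable_on UNIV" and dv: "\<And>n. (deriv ^^ n) v differentiable_on UNIV"
    and cu: "compact (closure {x. u x \<noteq> 0})" "closure {x. u x \<noteq> 0} \<subseteq> \<Omega>"
    and cv: "compact (closure {x. v x \<noteq> 0})" "closure {x. v x \<noteq> 0} \<subseteq> \<Omega>"
    using u v by (auto simp: test_functions_def)
  have "(deriv ^^ n) (\<lambda>x. u x + c * v x) differentiable_on UNIV" for n
    using du[of n] dv[of n] unfolding iterated_deriv_linear[OF du dv]
    by (auto simp: differentiable_on_def intro!: derivative_intros)
  moreover have sub: "closure {x. u x + c * v x \<noteq> 0} \<subseteq> closure {x. u x \<noteq> 0} \<union> closure {x. v x \<noteq> 0}"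
    unfolding closure_Un[symmetric] by (intro closure_mono) auto
  moreover have "compact (closure {x. u x + c * v x \<noteq> 0})"
    using compact_Int_closed[OF compact_Un[OF cu(1) cv(1)] closed_closure[of "{x. u x + c * v x \<noteq> 0}"]]
    by (simp only: Int_absorb1[OF sub])
  ultimately show ?thesis
    using cu cv by (auto simp: test_functions_def)
qed

lemma zero_in_test_functions: "(\<lambda>x. 0) \<in> test_functions \<Omega>"
proof -
  have "(deriv ^^ n) (\<lambda>x. 0) = (\<lambda>x. 0 :: real)" for n
    by (induction n) simp_all
  then show ?thesis by (simp add: test_functions_def)
qed

lemma sobolev_space_UNIV_iff:
  "w \<in> sobolev_space s UNIV \<longleftrightarrow> w \<in> borel_measurable borel \<and> sobolev_sq s UNIV w < \<infinity>"
  by (simp add: sobolev_space_def set_borel_measurable_def)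

text \<open>
  The closure expressed with the squared norm in \<open>ennreal\<close>, where estimates can be added without side
  conditions on finiteness.
\<close>

lemma sobolev_tilde_zero_iff:
  "w \<in> sobolev_tilde_zero s \<Omega> \<longleftrightarrow>
     w \<in> sobolev_space s UNIV \<and>
     (\<forall>\<epsilon>>0. \<exists>\<phi>\<in>test_functions \<Omega> \<inter> sobolev_space s UNIV.
        sobolev_sq s UNIV (\<lambda>x. w x - \<phi> x) < ennreal \<epsilon>)"
proof -
  have norm_iff: "sobolev_norm s UNIV (\<lambda>x. w x - \<phi> x) < \<epsilon> \<longleftrightarrow>
      sobolev_sq s UNIV (\<lambda>x. w x - \<phi> x) < ennreal (\<epsilon>\<^sup>2)"
    if W: "w \<in> sobolev_space s UNIV" "\<phi> \<in> sobolev_space s UNIV" and "\<epsilon> > 0" for \<phi> \<epsilon>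
  proof -
    obtain r where r: "r \<ge> 0" "sobolev_sq s UNIV (\<lambda>x. w x - \<phi> x) = ennreal r"
      using sobolev_sq_diff_finite[OF W] by (auto simp: less_top_ennreal)
    have "sqrt r < \<epsilon> \<longleftrightarrow> r < \<epsilon>\<^sup>2"
      using r(1) \<open>\<epsilon> > 0\<close> by (metis abs_of_pos real_sqrt_abs real_sqrt_less_iff)
    with r show ?thesis by (simp add: sobolev_norm_def ennreal_less_iff)
  qed
  show ?thesis
  proof (intro iffI conjI allI impI; (elim conjE)?)
    assume w: "w \<in> sobolev_tilde_zero s \<Omega>"
    then show W: "w \<in> sobolev_space s UNIV"
      by (simp add: sobolev_tilde_zero_def sobolev_closure_def)
    fix \<epsilon> :: real assume "\<epsilon> > 0"
    with w have "\<exists>\<phi>\<in>test_functions \<Omega> \<inter> sobolev_space s UNIV.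
        sobolev_norm s UNIV (\<lambda>x. w x - \<phi> x) < sqrt \<epsilon>"
      by (simp add: sobolev_tilde_zero_def sobolev_closure_def)
    then obtain \<phi> where \<phi>: "\<phi> \<in> test_functions \<Omega> \<inter> sobolev_space s UNIV"
      "sobolev_norm s UNIV (\<lambda>x. w x - \<phi> x) < sqrt \<epsilon>" ..
    then have "sobolev_sq s UNIV (\<lambda>x. w x - \<phi> x) < ennreal \<epsilon>"
      using norm_iff[OF W, of \<phi> "sqrt \<epsilon>"] \<open>\<epsilon> > 0\<close> by simp
    with \<phi>(1)
    show "\<exists>\<phi>\<in>test_functions \<Omega> \<inter> sobolev_space s UNIV. sobolev_sq s UNIV (\<lambda>x. w x - \<phi> x) < ennreal \<epsilon>"
      by (intro bexI[of _ \<phi>])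
  next
    assume W: "w \<in> sobolev_space s UNIV" and
      approx: "\<forall>\<epsilon>>0. \<exists>\<phi>\<in>test_functions \<Omega> \<inter> sobolev_space s UNIV.
        sobolev_sq s UNIV (\<lambda>x. w x - \<phi> x) < ennreal \<epsilon>"
    have "\<exists>\<phi>\<in>test_functions \<Omega> \<inter> sobolev_space s UNIV. sobolev_norm s UNIV (\<lambda>x. w x - \<phi> x) < \<epsilon>"
      if "\<epsilon> > 0" for \<epsilon>
    proof -
      obtain \<phi> where "\<phi> \<in> test_functions \<Omega> \<inter> sobolev_space s UNIV"
        "sobolev_sq s UNIV (\<lambda>x. w x - \<phi> x) < ennreal (\<epsilon>\<^sup>2)"
        using approx[rule_format, of "\<epsilon>\<^sup>2"] \<open>\<epsilon> > 0\<close> by (meson zero_less_power)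
      then show ?thesis
        using norm_iff[OF W _ \<open>\<epsilon> > 0\<close>] by (intro bexI[of _ \<phi>]) simp_all
    qed
    with W show "w \<in> sobolev_tilde_zero s \<Omega>"
      by (simp add: sobolev_tilde_zero_def sobolev_closure_def)
  qed
qed

lemma sobolev_tilde_zero_approx:
  assumes "w \<in> sobolev_tilde_zero s \<Omega>" "0 < \<epsilon>"
  obtains \<phi> where "\<phi> \<in> test_functions \<Omega>" "\<phi> \<in> sobolev_space s UNIV"
    "sobolev_sq s UNIV (\<lambda>x. w x - \<phi> x) < ennreal \<epsilon>"
proof -
  have "\<exists>\<phi>\<in>test_functions \<Omega> \<inter> sobolev_space s UNIV. sobolev_sq s UNIV (\<lambda>x. w x - \<phi> x) < ennreal \<epsilon>"
    using assms by (simp add: sobolev_tilde_zero_iff)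
  with that show thesis by blast
qed

lemma sobolev_sq_lincomb_le:
  assumes [measurable]: "u \<in> borel_measurable borel" "v \<in> borel_measurable borel"
  shows "sobolev_sq (\<beta> / 2) UNIV (\<lambda>x. u x + c * v x) \<le>
           2 * sobolev_sq (\<beta> / 2) UNIV u + ennreal (2 * c\<^sup>2) * sobolev_sq (\<beta> / 2) UNIV v"
proof -
  have "sobolev_sq (\<beta> / 2) UNIV (\<lambda>x. u x + c * v x) = sobolev_sq (\<beta> / 2) UNIV (\<lambda>x. u x - (- c) * v x)"
    by simp
  also have "\<dots> \<le> 2 * sobolev_sq (\<beta> / 2) UNIV u + 2 * sobolev_sq (\<beta> / 2) UNIV (\<lambda>x. (- c) * v x)"
    by (intro sobolev_sq_diff_le) measurable
  also have "sobolev_sq (\<beta> / 2) UNIV (\<lambda>x. (- c) * v x) = ennreal (c\<^sup>2) * sobolev_sq (\<beta> / 2) UNIV v"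
    by (subst sobolev_sq_scale) simp_all
  finally show ?thesis
    by (simp add: ennreal_mult mult.assoc)
qed

lemma sobolev_space_linear:
  assumes "u \<in> sobolev_space (\<beta> / 2) UNIV" "v \<in> sobolev_space (\<beta> / 2) UNIV"
  shows "(\<lambda>x. u x + c * v x) \<in> sobolev_space (\<beta> / 2) UNIV"
proof -
  have "2 * sobolev_sq (\<beta> / 2) UNIV u + ennreal (2 * c\<^sup>2) * sobolev_sq (\<beta> / 2) UNIV v < \<infinity>"
    using assms by (auto simp: sobolev_space_UNIV_iff ennreal_mult_less_top)
  then show ?thesis
    using assms by (auto simp: sobolev_space_UNIV_iff intro: le_less_trans[OF sobolev_sq_lincomb_le])
qed

lemma sobolev_tilde_zero_linear:
  assumes u: "u \<in> sobolev_tilde_zero (\<beta> / 2) \<Omega>" and v: "v \<in> sobolev_tilde_zero (\<beta> / 2) \<Omega>"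
  shows "(\<lambda>x. u x + c * v x) \<in> sobolev_tilde_zero (\<beta> / 2) \<Omega>"
  unfolding sobolev_tilde_zero_iff
proof (intro conjI allI impI)
  let ?H = "sobolev_space (\<beta> / 2) UNIV" and ?sq = "sobolev_sq (\<beta> / 2) UNIV"
  have uH: "u \<in> ?H" and vH: "v \<in> ?H"
    using u v by (simp_all add: sobolev_tilde_zero_iff)
  then show "(\<lambda>x. u x + c * v x) \<in> ?H" by (rule sobolev_space_linear)
  fix \<epsilon> :: real assume "\<epsilon> > 0"
  define \<delta> where "\<delta> = \<epsilon> / (4 + 4 * c\<^sup>2)"
  have pos: "4 + 4 * c\<^sup>2 > 0" by (simp add: add_pos_nonneg)
  then have "\<delta> > 0" using \<open>\<epsilon> > 0\<close> by (simp add: \<delta>_def)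
  have "(4 + 4 * c\<^sup>2) * \<delta> = \<epsilon>" using pos by (simp add: \<delta>_def)
  then have \<delta>: "2 * \<delta> + 2 * c\<^sup>2 * \<delta> = \<epsilon> / 2"
    by (simp add: algebra_simps)
  obtain \<phi> where \<phi>: "\<phi> \<in> test_functions \<Omega>" "\<phi> \<in> ?H" "?sq (\<lambda>x. u x - \<phi> x) < ennreal \<delta>"
    by (rule sobolev_tilde_zero_approx[OF u \<open>\<delta> > 0\<close>])
  obtain \<psi> where \<psi>: "\<psi> \<in> test_functions \<Omega>" "\<psi> \<in> ?H" "?sq (\<lambda>x. v x - \<psi> x) < ennreal \<delta>"
    by (rule sobolev_tilde_zero_approx[OF v \<open>\<delta> > 0\<close>])
  have [measurable]: "u \<in> borel_measurable borel" "v \<in> borel_measurable borel"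
    "\<phi> \<in> borel_measurable borel" "\<psi> \<in> borel_measurable borel"
    using uH vH \<phi> \<psi> by (simp_all add: sobolev_space_UNIV_iff)
  have "?sq (\<lambda>x. (u x + c * v x) - (\<phi> x + c * \<psi> x)) = ?sq (\<lambda>x. (u x - \<phi> x) + c * (v x - \<psi> x))"
    by (simp add: algebra_simps)
  also have "\<dots> \<le> 2 * ?sq (\<lambda>x. u x - \<phi> x) + ennreal (2 * c\<^sup>2) * ?sq (\<lambda>x. v x - \<psi> x)"
    by (intro sobolev_sq_lincomb_le) measurable
  also have "\<dots> \<le> 2 * ennreal \<delta> + ennreal (2 * c\<^sup>2) * ennreal \<delta>"
    using \<phi>(3) \<psi>(3) by (intro add_mono mult_left_mono) auto
  also have "\<dots> = ennreal (2 * \<delta> + 2 * c\<^sup>2 * \<delta>)"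
    using \<open>\<delta> > 0\<close> by (simp add: ennreal_mult)
  finally have "?sq (\<lambda>x. (u x + c * v x) - (\<phi> x + c * \<psi> x)) < ennreal \<epsilon>"
    using \<open>\<epsilon> > 0\<close> by (simp add: \<delta> ennreal_lessI le_less_trans)
  then show "\<exists>\<theta>\<in>test_functions \<Omega> \<inter> ?H. ?sq (\<lambda>x. u x + c * v x - \<theta> x) < ennreal \<epsilon>"
    using test_functions_linear[OF \<phi>(1) \<psi>(1)] sobolev_space_linear[OF \<phi>(2) \<psi>(2)]
    by (intro bexI[of _ "\<lambda>x. \<phi> x + c * \<psi> x"]) simp_all
qed

lemma zero_in_sobolev_tilde_zero: "(\<lambda>x. 0) \<in> sobolev_tilde_zero s \<Omega>"
proof -
  have 0: "sobolev_sq s UNIV (\<lambda>x. 0) = 0" by (simp add: sobolev_sq_def)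
  then have "(\<lambda>x. 0) \<in> test_functions \<Omega> \<inter> sobolev_space s UNIV"
    using zero_in_test_functions by (simp add: sobolev_space_UNIV_iff)
  then show ?thesis
    using 0 by (auto simp: sobolev_tilde_zero_iff intro!: bexI[of _ "\<lambda>x. 0"])
qed

lemma sobolev_tilde_zero_closed:
  assumes u: "\<And>n. u n \<in> sobolev_tilde_zero (\<beta> / 2) \<Omega>" and w: "w \<in> borel_measurable borel"
    and lim: "(\<lambda>n. sobolev_sq (\<beta> / 2) UNIV (\<lambda>x. u n x - w x)) \<longlonglongrightarrow> 0"
  shows "w \<in> sobolev_tilde_zero (\<beta> / 2) \<Omega>"
  unfolding sobolev_tilde_zero_iff
proof (intro conjI allI impI)
  let ?H = "sobolev_space (\<beta> / 2) UNIV" and ?sq = "sobolev_sq (\<beta> / 2) UNIV"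
  have uH: "u n \<in> ?H" for n using u by (simp add: sobolev_tilde_zero_iff)
  note [measurable] = w
  have [measurable]: "u n \<in> borel_measurable borel" for n
    using uH by (simp add: sobolev_space_UNIV_iff)
  have small: "\<exists>n. ?sq (\<lambda>x. u n x - w x) < ennreal \<epsilon>" if "\<epsilon> > 0" for \<epsilon>
    using order_tendstoD(2)[OF lim, of "ennreal \<epsilon>"] that by (auto simp: eventually_sequentially)
  obtain n where "?sq (\<lambda>x. u n x - w x) < ennreal 1" using small[of 1] by auto
  then have "(\<lambda>x. u n x - w x) \<in> ?H"
    by (auto simp: sobolev_space_UNIV_iff intro: less_trans)
  from sobolev_space_linear[OF uH[of n] this, of "-1"] show "w \<in> ?H" by simp
  fix \<epsilon> :: real assume "\<epsilon> > 0"
  obtain n where n: "?sq (\<lambda>x. u n x - w x) < ennreal (\<epsilon> / 8)"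
    using small[of "\<epsilon> / 8"] \<open>\<epsilon> > 0\<close> by auto
  obtain \<phi> where \<phi>: "\<phi> \<in> test_functions \<Omega>" "\<phi> \<in> ?H" "?sq (\<lambda>x. u n x - \<phi> x) < ennreal (\<epsilon> / 8)"
    using \<open>\<epsilon> > 0\<close> by (auto intro: sobolev_tilde_zero_approx[OF u[of n], of "\<epsilon> / 8"])
  have [measurable]: "\<phi> \<in> borel_measurable borel"
    using \<phi> by (simp add: sobolev_space_UNIV_iff)
  have "?sq (\<lambda>x. w x - \<phi> x) = ?sq (\<lambda>x. (u n x - \<phi> x) - (u n x - w x))"
    by simp
  also have "\<dots> \<le> 2 * ?sq (\<lambda>x. u n x - \<phi> x) + 2 * ?sq (\<lambda>x. u n x - w x)"
    by (intro sobolev_sq_diff_le) measurable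
  also have "\<dots> \<le> 2 * ennreal (\<epsilon> / 8) + 2 * ennreal (\<epsilon> / 8)"
    using n \<phi>(3) by (intro add_mono mult_left_mono) auto
  also have "\<dots> = ennreal (2 * (\<epsilon> / 8) + 2 * (\<epsilon> / 8))"
    using \<open>\<epsilon> > 0\<close> by (simp only: ennreal_plus ennreal_mult ennreal_numeral)
  also have "\<dots> < ennreal \<epsilon>"
    using \<open>\<epsilon> > 0\<close> by (intro ennreal_lessI) simp_all
  finally show "\<exists>\<theta>\<in>test_functions \<Omega> \<inter> ?H. ?sq (\<lambda>x. w x - \<theta> x) < ennreal \<epsilon>"
    using \<phi> by (intro bexI[of _ \<phi>]) simp_all
qed

text \<open>
  Test functions vanish outside \<open>\<Omega>\<close>, so the integral of \<open>w\<^sup>2\<close> over the complement is at most the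
  squared distance of \<open>w\<close> to any of them, which can be made arbitrarily small.
\<close>

lemma sobolev_tilde_zero_AE_vanishes_outside:
  assumes w: "w \<in> sobolev_tilde_zero s \<Omega>" and \<Omega>: "\<Omega> \<in> sets borel"
  shows "AE x in lborel. x \<notin> \<Omega> \<longrightarrow> w x = 0"
proof -
  have [measurable]: "w \<in> borel_measurable borel"
    using w by (simp add: sobolev_tilde_zero_iff sobolev_space_UNIV_iff)
  note [measurable] = \<Omega>
  define I where "I = (\<integral>\<^sup>+x. ennreal ((w x)\<^sup>2) * indicator (- \<Omega>) x \<partial>lborel)"
  have "I \<le> ennreal \<epsilon>" if "\<epsilon> > 0" for \<epsilon>
  proof -
    obtain \<phi> where \<phi>: "\<phi> \<in> test_functions \<Omega>" "sobolev_sq s UNIV (\<lambda>x. w x - \<phi> x) < ennreal \<epsilon>"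
      by (rule sobolev_tilde_zero_approx[OF w \<open>\<epsilon> > 0\<close>])
    have "\<phi> x = 0" if "x \<notin> \<Omega>" for x
      using \<phi>(1) that closure_subset[of "{x. \<phi> x \<noteq> 0}"] by (auto simp: test_functions_def)
    then have "I \<le> (\<integral>\<^sup>+x. ennreal ((w x - \<phi> x)\<^sup>2) \<partial>lborel)"
      unfolding I_def by (intro nn_integral_mono) (auto simp: indicator_def)
    also have "\<dots> \<le> sobolev_sq s UNIV (\<lambda>x. w x - \<phi> x)"
      by (simp add: sobolev_sq_def)
    finally show ?thesis using \<phi>(2) by simp
  qed
  then have "I \<le> 0" by (rule_tac ennreal_le_epsilon) simp
  then have "I = 0" by simp
  then have "AE x in lborel. ennreal ((w x)\<^sup>2) * indicator (- \<Omega>) x = 0"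
    unfolding I_def by (subst (asm) nn_integral_0_iff_AE) auto
  then show ?thesis
    by eventually_elim (auto simp: indicator_def split: if_splits)
qed

section \<open>Coercivity\<close>

text \<open>
  The long-range part of the untempered kernel on one side, beyond the distance up to which
  \<open>exp (- lam * r)\<close> has the lower bound \<open>exp (- lam)\<close>.
\<close>

definition power_tail :: "real \<Rightarrow> real \<Rightarrow> ennreal" where
  "power_tail \<beta> r = ennreal (r powr (- 1 - \<beta>)) * indicator {1..} r"

lemma power_tail_measurable [measurable]: "power_tail \<beta> \<in> borel_measurable borel"
  unfolding power_tail_def by measurable

lemma nn_integral_power_tail:
  assumes "0 < \<beta>"
  shows "(\<integral>\<^sup>+r. power_tail \<beta> r \<partial>lborel) = ennreal (1 / \<beta>)"
proof -
  have "(\<integral>\<^sup>+r. ennreal (r powr (- 1 - \<beta>)) * indicator {1..} r \<partial>lborel) =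
      ennreal (0 - (- (1 powr (- \<beta>)) / \<beta>))"
  proof (rule nn_integral_FTC_atLeast[where F = "\<lambda>r. - (r powr (- \<beta>)) / \<beta>"])
    show "((\<lambda>r. - (r powr (- \<beta>)) / \<beta>) \<longlongrightarrow> 0) at_top"
      using assms by real_asymp
    show "((\<lambda>r. - (r powr (- \<beta>)) / \<beta>) has_real_derivative r powr (- 1 - \<beta>)) (at r)" if "1 \<le> r" for r
      using that assms by (auto intro!: derivative_eq_intros simp: field_simps)
        (simp add: minus_diff_commute)
  qed auto
  then show ?thesis by (simp add: power_tail_def)
qed

lemma nn_integral_two_sided_power_tail:
  assumes "0 < \<beta>"
  shows "(\<integral>\<^sup>+y. power_tail \<beta> (y - x) + power_tail \<beta> (x - y) \<partial>lborel) = ennreal (2 / \<beta>)"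
proof -
  have "(\<integral>\<^sup>+y. power_tail \<beta> (y - x) \<partial>lborel) = ennreal (1 / \<beta>)"
    using nn_integral_real_affine[of "power_tail \<beta>" 1 "- x"] nn_integral_power_tail[OF assms] by simp
  moreover have "(\<integral>\<^sup>+y. power_tail \<beta> (x - y) \<partial>lborel) = ennreal (1 / \<beta>)"
    using nn_integral_real_affine[of "power_tail \<beta>" "-1" x] nn_integral_power_tail[OF assms] by simp
  ultimately have "(\<integral>\<^sup>+y. power_tail \<beta> (y - x) + power_tail \<beta> (x - y) \<partial>lborel) = ennreal (1 / \<beta>) + ennreal (1 / \<beta>)"
    by (subst nn_integral_add) simp_all
  also have "\<dots> = ennreal (2 / \<beta>)"
    using assms by (simp flip: ennreal_plus)
  finally show ?thesis .
qed

text \<open>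
  For \<open>r \<le> 1\<close> removing the tempering costs at most the factor \<open>exp lam\<close>.  For \<open>r > 1\<close> the difference
  is estimated by \<open>(p - q)\<^sup>2 \<le> 2 * p\<^sup>2 + 2 * q\<^sup>2\<close>, and each of the two squares, integrated against a
  kernel of total weight \<open>2 / \<beta>\<close>, contributes \<open>4 / \<beta>\<close> times the mass.
\<close>

lemma energy_0_le:
  assumes [measurable]: "w \<in> borel_measurable borel" and \<beta>: "0 < \<beta>" and lam: "0 \<le> lam"
  shows "energy \<beta> 0 w \<le> ennreal (exp lam) * energy \<beta> lam w + ennreal (8 / \<beta>) * mass w"
proof -
  define T where "T = (\<lambda>z. power_tail \<beta> (snd z - fst z) + power_tail \<beta> (fst z - snd z))"
  have [measurable]: "T \<in> borel_measurable (lborel \<Otimes>\<^sub>M lborel)"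
    unfolding T_def by measurable
  have pointwise: "ennreal (energy_density \<beta> 0 w w z) \<le> ennreal (exp lam) * ennreal (energy_density \<beta> lam w w z) +
      (2 * (ennreal ((w (fst z))\<^sup>2) * T z) + 2 * (ennreal ((w (snd z))\<^sup>2) * T z))" for z
  proof (cases "\<bar>fst z - snd z\<bar> \<le> 1")
    case True
    define r where "r = \<bar>fst z - snd z\<bar>"
    have "energy_density \<beta> 0 w w z = exp (lam * r) * energy_density \<beta> lam w w z"
      by (simp add: energy_density_def r_def)
    also have "\<dots> \<le> exp lam * energy_density \<beta> lam w w z"
      using True lam by (intro mult_right_mono) (auto simp: r_def intro: mult_left_le)
    finally have "ennreal (energy_density \<beta> 0 w w z) \<le> ennreal (exp lam) * ennreal (energy_density \<beta> lam w w z)"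
      by (simp flip: ennreal_mult add: ennreal_leI)
    then show ?thesis by (rule order_trans) simp
  next
    case False
    define r where "r = \<bar>fst z - snd z\<bar>"
    have "T z = ennreal (r powr (- 1 - \<beta>))"
      using False by (auto simp: T_def power_tail_def r_def indicator_def abs_if)
    moreover have "energy_density \<beta> 0 w w z = (w (fst z) - w (snd z))\<^sup>2 * r powr (- 1 - \<beta>)"
      using powr_minus_divide[of r "1 + \<beta>"]
      by (simp add: energy_density_def r_def power2_eq_square)
    moreover have "(a - b)\<^sup>2 \<le> 2 * a\<^sup>2 + 2 * b\<^sup>2" for a b :: real
      using zero_le_power2[of "a + b"] by (simp add: power2_eq_square algebra_simps)
    from mult_right_mono[OF this[of "w (fst z)" "w (snd z)"], of "r powr (- 1 - \<beta>)"]
    have "(w (fst z) - w (snd z))\<^sup>2 * r powr (- 1 - \<beta>) \<le>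
        2 * ((w (fst z))\<^sup>2 * r powr (- 1 - \<beta>)) + 2 * ((w (snd z))\<^sup>2 * r powr (- 1 - \<beta>))"
      by (simp add: algebra_simps)
    ultimately have "ennreal (energy_density \<beta> 0 w w z) \<le>
        2 * (ennreal ((w (fst z))\<^sup>2) * T z) + 2 * (ennreal ((w (snd z))\<^sup>2) * T z)"
      by (simp add: ennreal_leI flip: ennreal_mult ennreal_plus ennreal_numeral)
    then show ?thesis by (rule order_trans) simp
  qed
  have 1: "(\<integral>\<^sup>+z. ennreal ((w (fst z))\<^sup>2) * T z \<partial>(lborel \<Otimes>\<^sub>M lborel)) = ennreal (2 / \<beta>) * mass w"
  proof -
    have "(\<integral>\<^sup>+z. ennreal ((w (fst z))\<^sup>2) * T z \<partial>(lborel \<Otimes>\<^sub>M lborel)) =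
        (\<integral>\<^sup>+x. (\<integral>\<^sup>+y. ennreal ((w x)\<^sup>2) * T (x, y) \<partial>lborel) \<partial>lborel)"
      by (subst lborel.nn_integral_fst[symmetric]) simp_all
    also have "\<dots> = (\<integral>\<^sup>+x. ennreal ((w x)\<^sup>2) * ennreal (2 / \<beta>) \<partial>lborel)"
      by (simp add: T_def nn_integral_cmult nn_integral_two_sided_power_tail[OF \<beta>])
    also have "\<dots> = mass w * ennreal (2 / \<beta>)"
      by (simp add: nn_integral_multc mass_def)
    finally show ?thesis by (simp only: mult.commute[of "ennreal (2 / \<beta>)"])
  qed
  have 2: "(\<integral>\<^sup>+z. ennreal ((w (snd z))\<^sup>2) * T z \<partial>(lborel \<Otimes>\<^sub>M lborel)) = ennreal (2 / \<beta>) * mass w"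
  proof -
    have "(\<integral>\<^sup>+z. ennreal ((w (snd z))\<^sup>2) * T z \<partial>(lborel \<Otimes>\<^sub>M lborel)) =
        (\<integral>\<^sup>+y. (\<integral>\<^sup>+x. ennreal ((w y)\<^sup>2) * T (x, y) \<partial>lborel) \<partial>lborel)"
      by (subst lborel_pair.nn_integral_snd[symmetric]) simp_all
    also have "\<dots> = (\<integral>\<^sup>+y. ennreal ((w y)\<^sup>2) * ennreal (2 / \<beta>) \<partial>lborel)"
      using nn_integral_two_sided_power_tail[OF \<beta>]
      by (simp add: T_def nn_integral_cmult add.commute)
    also have "\<dots> = mass w * ennreal (2 / \<beta>)"
      by (simp add: nn_integral_multc mass_def)
    finally show ?thesis by (simp only: mult.commute[of "ennreal (2 / \<beta>)"])
  qed
  have "energy \<beta> 0 w \<le> (\<integral>\<^sup>+z. ennreal (exp lam) * ennreal (energy_density \<beta> lam w w z) +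
      (2 * (ennreal ((w (fst z))\<^sup>2) * T z) + 2 * (ennreal ((w (snd z))\<^sup>2) * T z)) \<partial>(lborel \<Otimes>\<^sub>M lborel))"
    unfolding energy_def by (intro nn_integral_mono pointwise)
  also have "\<dots> = ennreal (exp lam) * energy \<beta> lam w +
      (2 * (ennreal (2 / \<beta>) * mass w) + 2 * (ennreal (2 / \<beta>) * mass w))"
    unfolding energy_def 1[symmetric] using 1 2 by (simp add: nn_integral_add nn_integral_cmult)
  also have "2 * (ennreal (2 / \<beta>) * mass w) + 2 * (ennreal (2 / \<beta>) * mass w) =
      (2 * ennreal (2 / \<beta>) + 2 * ennreal (2 / \<beta>)) * mass w"
    by (simp add: distrib_right mult.assoc)
  also have "2 * ennreal (2 / \<beta>) + 2 * ennreal (2 / \<beta>) = ennreal (8 / \<beta>)"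
    using \<beta> by (simp flip: ennreal_plus ennreal_mult ennreal_numeral)
  finally show ?thesis .
qed

text \<open>
  A fractional Poincare inequality.  For \<open>x\<close> in \<open>(a, b)\<close> and \<open>y\<close> in the adjacent interval
  \<open>(b, b + L)\<close> the difference \<open>w x - w y\<close> is almost always \<open>w x\<close> and the distance is at most \<open>2 * L\<close>, so the kernel
  is at least its value at distance \<open>2 * L\<close>.  Integrating over \<open>y\<close> gives the factor \<open>L\<close>.
\<close>

lemma mass_le_energy:
  assumes [measurable]: "w \<in> borel_measurable borel" and "a < b" "0 < \<beta>" "0 \<le> lam"
    and zero: "AE x in lborel. x \<notin> {a<..<b} \<longrightarrow> w x = 0"
    and L_def: "L = b - a"
  shows "ennreal (L / (exp (lam * (2 * L)) * (2 * L) powr (1 + \<beta>))) * mass w \<le> energy \<beta> lam w"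
proof -
  define m where "m = 1 / (exp (lam * (2 * L)) * (2 * L) powr (1 + \<beta>))"
  have "0 < L" using \<open>a < b\<close> by (simp add: L_def)
  then have "0 < m" by (simp add: m_def)
  have lower: "ennreal (m * (w x)\<^sup>2) \<le> ennreal (energy_density \<beta> lam w w (x, y))"
    if "x \<in> {a<..<b}" "y \<in> {b<..<b + L}" "w y = 0" for x y
  proof -
    have r: "0 < \<bar>x - y\<bar>" "\<bar>x - y\<bar> \<le> 2 * L" using that by (auto simp: L_def)
    then have "exp (lam * \<bar>x - y\<bar>) * \<bar>x - y\<bar> powr (1 + \<beta>) \<le> exp (lam * (2 * L)) * (2 * L) powr (1 + \<beta>)"
      using \<open>0 \<le> lam\<close> \<open>0 < \<beta>\<close> by (intro mult_mono powr_mono2) (auto intro: mult_left_mono)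
    then have "m \<le> 1 / (exp (lam * \<bar>x - y\<bar>) * \<bar>x - y\<bar> powr (1 + \<beta>))"
      unfolding m_def using r by (intro divide_left_mono) (auto intro!: mult_pos_pos)
    from mult_right_mono[OF this, of "(w x)\<^sup>2"] show ?thesis
      using \<open>w y = 0\<close> by (intro ennreal_leI) (simp add: energy_density_def power2_eq_square)
  qed
  have "ennreal (m * L) * ennreal ((w x)\<^sup>2) \<le> (\<integral>\<^sup>+y. ennreal (energy_density \<beta> lam w w (x, y)) \<partial>lborel)"
    if "x \<in> {a<..<b}" for x
  proof -
    have "ennreal (m * L) * ennreal ((w x)\<^sup>2) =
        (\<integral>\<^sup>+y. ennreal (m * (w x)\<^sup>2) * indicator {b<..<b + L} y \<partial>lborel)"
      using \<open>0 < L\<close> \<open>0 < m\<close>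
      by (subst nn_integral_cmult_indicator) (simp_all add: mult_ac flip: ennreal_mult)
    also have "\<dots> \<le> (\<integral>\<^sup>+y. ennreal (energy_density \<beta> lam w w (x, y)) \<partial>lborel)"
    proof (rule nn_integral_mono_AE, use zero in eventually_elim)
      case (elim y)
      then show ?case using lower[OF that, of y] by (auto simp: indicator_def)
    qed
    finally show ?thesis .
  qed
  then have "ennreal (m * L) * ennreal ((w x)\<^sup>2) \<le> (\<integral>\<^sup>+y. ennreal (energy_density \<beta> lam w w (x, y)) \<partial>lborel)"
    if "x \<notin> {a<..<b} \<longrightarrow> w x = 0" for x
    using that by (cases "x \<in> {a<..<b}") auto
  then have "(\<integral>\<^sup>+x. ennreal (m * L) * ennreal ((w x)\<^sup>2) \<partial>lborel) \<le>
      (\<integral>\<^sup>+x. (\<integral>\<^sup>+y. ennreal (energy_density \<beta> lam w w (x, y)) \<partial>lborel) \<partial>lborel)"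
    using zero by (intro nn_integral_mono_AE) auto
  also have "\<dots> = energy \<beta> lam w"
    unfolding energy_def by (subst lborel.nn_integral_fst) simp_all
  finally have "ennreal (m * L) * mass w \<le> energy \<beta> lam w"
    by (simp add: nn_integral_cmult mass_def)
  then show ?thesis by (simp add: m_def)
qed

text \<open>
  Removing the tempering produces a multiple of the mass, which the Poincare inequality absorbs into
  the energy.
\<close>

lemma sobolev_tilde_zero_coercive:
  assumes "a < b" and \<beta>: "0 < \<beta>" and lam: "0 \<le> lam"
  obtains C where "0 < C"
    and "\<And>w. w \<in> sobolev_tilde_zero (\<beta> / 2) {a<..<b} \<Longrightarrow>
           sobolev_sq (\<beta> / 2) UNIV w \<le> ennreal C * energy \<beta> lam w"
proof -
  define L where "L = b - a"
  define M where "M = L / (exp (lam * (2 * L)) * (2 * L) powr (1 + \<beta>))"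
  have "0 < L" using \<open>a < b\<close> by (simp add: L_def)
  then have M: "0 < M" by (simp add: M_def)
  define C where "C = (1 + 8 / \<beta>) / M + exp lam"
  have "0 < C" using M \<beta> by (simp add: C_def add_pos_pos)
  moreover have "sobolev_sq (\<beta> / 2) UNIV w \<le> ennreal C * energy \<beta> lam w"
    if w: "w \<in> sobolev_tilde_zero (\<beta> / 2) {a<..<b}" for w
  proof -
    have [measurable]: "w \<in> borel_measurable borel"
      using w by (simp add: sobolev_tilde_zero_iff sobolev_space_UNIV_iff)
    have "ennreal M * mass w \<le> energy \<beta> lam w"
      unfolding M_def using assms sobolev_tilde_zero_AE_vanishes_outside[OF w]
      by (intro mass_le_energy[OF _ _ _ _ _ L_def]) simp_all
    then have "ennreal ((1 + 8 / \<beta>) / M) * (ennreal M * mass w) \<le>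
        ennreal ((1 + 8 / \<beta>) / M) * energy \<beta> lam w"
      by (intro mult_left_mono) simp_all
    moreover have "ennreal ((1 + 8 / \<beta>) / M) * (ennreal M * mass w) = ennreal (1 + 8 / \<beta>) * mass w"
      using M \<beta> by (simp add: mult.assoc[symmetric] flip: ennreal_mult)
    ultimately have mass: "ennreal (1 + 8 / \<beta>) * mass w \<le> ennreal ((1 + 8 / \<beta>) / M) * energy \<beta> lam w"
      by simp
    have "sobolev_sq (\<beta> / 2) UNIV w = mass w + energy \<beta> 0 w"
      by (rule sobolev_sq_eq_mass_plus_energy) simp
    also have "\<dots> \<le> mass w + (ennreal (exp lam) * energy \<beta> lam w + ennreal (8 / \<beta>) * mass w)"
      by (intro add_left_mono energy_0_le \<beta> lam) simp
    also have "\<dots> = ennreal (1 + 8 / \<beta>) * mass w + ennreal (exp lam) * energy \<beta> lam w"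
      using \<beta> by (simp add: distrib_right add_ac)
    also have "\<dots> \<le> ennreal ((1 + 8 / \<beta>) / M) * energy \<beta> lam w + ennreal (exp lam) * energy \<beta> lam w"
      by (intro add_right_mono mass)
    also have "\<dots> = ennreal C * energy \<beta> lam w"
      using M \<beta> unfolding C_def by (subst ennreal_plus) (simp_all add: distrib_right)
    finally show ?thesis .
  qed
  ultimately show thesis by (rule that)
qed

section \<open>Bounded functionals and well-posedness\<close>

lemma sobolev_space_energy_density_integrable:
  assumes "u \<in> sobolev_space (\<beta> / 2) UNIV" "v \<in> sobolev_space (\<beta> / 2) UNIV" "0 \<le> lam"
  shows "integrable (lborel \<Otimes>\<^sub>M lborel) (energy_density \<beta> lam u v)"
proof -
  have "energy \<beta> lam w < \<infinity>" if "w \<in> sobolev_space (\<beta> / 2) UNIV" for w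
  proof -
    have w: "w \<in> borel_measurable borel" "sobolev_sq (\<beta> / 2) UNIV w < \<infinity>"
      using that by (simp_all add: sobolev_space_UNIV_iff)
    have "energy \<beta> lam w \<le> energy \<beta> 0 w"
      using w(1) assms(3) by (rule energy_le_energy_0)
    also have "\<dots> \<le> sobolev_sq (\<beta> / 2) UNIV w"
      by (simp add: sobolev_sq_eq_mass_plus_energy[OF w(1)])
    finally show ?thesis using w(2) by (rule le_less_trans)
  qed
  then show ?thesis
    using assms by (intro energy_density_integrable) (simp_all add: sobolev_space_UNIV_iff)
qed

lemma sobolev_norm_power2:
  assumes "sobolev_sq s E w < \<infinity>"
  shows "ennreal ((sobolev_norm s E w)\<^sup>2) = sobolev_sq s E w"
  using assms by (simp add: sobolev_norm_def less_top)

text \<open>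
  Needed because the supremum that defines \<open>sobolev_dual_norm\<close> is taken in the reals and carries no
  information unless the set is bounded.
\<close>

lemma sobolev_dual_bdd_above:
  assumes "f \<in> sobolev_dual s \<Omega>"
  shows "bdd_above ((\<lambda>v. \<bar>f v\<bar>) ` {v \<in> sobolev_zero s \<Omega>. sobolev_norm s \<Omega> v \<le> 1})"
proof -
  obtain K where K: "\<And>v. v \<in> sobolev_zero s \<Omega> \<Longrightarrow> \<bar>f v\<bar> \<le> K * sobolev_norm s \<Omega> v"
    using assms unfolding sobolev_dual_def by blast
  show ?thesis
  proof (rule bdd_aboveI2)
    fix v assume v: "v \<in> {v \<in> sobolev_zero s \<Omega>. sobolev_norm s \<Omega> v \<le> 1}"
    have "0 \<le> sobolev_norm s \<Omega> v" by (simp add: sobolev_norm_def)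
    then have "K * sobolev_norm s \<Omega> v \<le> \<bar>K\<bar> * 1"
      using v by (intro mult_mono) auto
    with K[of v] v show "\<bar>f v\<bar> \<le> \<bar>K\<bar>" by simp
  qed
qed

text \<open>
  Scale \<open>v\<close> into the unit ball.  If \<open>v\<close> has norm \<open>0\<close>, all its multiples lie in the unit ball, and
  \<open>f\<close> could be bounded on them only if \<open>f v = 0\<close>.  The norm over the line dominates the norm over \<open>\<Omega>\<close>,
  so the dual norm, which is formed with the latter, can be paired with the former.
\<close>

lemma sobolev_dual_norm_bound:
  assumes f: "f \<in> sobolev_dual (\<beta> / 2) \<Omega>" and "open \<Omega>"
    and v: "v \<in> sobolev_tilde_zero (\<beta> / 2) \<Omega>"
  shows "\<bar>f v\<bar> \<le> sobolev_dual_norm (\<beta> / 2) \<Omega> f * sobolev_norm (\<beta> / 2) UNIV v"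
proof -
  let ?V = "sobolev_tilde_zero (\<beta> / 2) \<Omega>" and ?N = "sobolev_norm (\<beta> / 2)"
  let ?D = "sobolev_dual_norm (\<beta> / 2) \<Omega> f"
  have sub: "?V \<subseteq> sobolev_zero (\<beta> / 2) \<Omega>"
    using \<open>open \<Omega>\<close> by (rule sobolev_tilde_zero_subset)
  have scale: "f (\<lambda>x. c * u x) = c * f u" "(\<lambda>x. c * u x) \<in> ?V" if "u \<in> ?V" for c u
    using f that sub sobolev_tilde_zero_linear[OF zero_in_sobolev_tilde_zero that, of c]
    by (auto simp: sobolev_dual_def)
  have N_scale: "?N UNIV (\<lambda>x. c * u x) = \<bar>c\<bar> * ?N UNIV u" if "u \<in> ?V" for c u
  proof -
    have "u \<in> borel_measurable borel"
      using that by (simp add: sobolev_tilde_zero_iff sobolev_space_UNIV_iff)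
    then show ?thesis
      by (simp add: sobolev_norm_def sobolev_sq_scale enn2real_mult real_sqrt_mult)
  qed
  have N_mono: "?N \<Omega> u \<le> ?N UNIV u" if "u \<in> ?V" for u
    using that unfolding sobolev_norm_def sobolev_tilde_zero_iff sobolev_space_UNIV_iff
    by (intro real_sqrt_le_mono enn2real_mono sobolev_sq_mono) auto
  have unit: "\<bar>f u\<bar> \<le> ?D" if "u \<in> ?V" "?N UNIV u \<le> 1" for u
    unfolding sobolev_dual_norm_def using that sub N_mono[of u]
    by (intro cSUP_upper sobolev_dual_bdd_above[OF f]) auto
  show ?thesis
  proof (cases "?N UNIV v = 0")
    case True
    have "f v = 0"
    proof (rule ccontr)
      assume "f v \<noteq> 0"
      \<comment> \<open>The multiple of \<open>v\<close> on which \<open>f\<close> takes a value above the dual norm.\<close>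
      define k where "k = (?D + 1) / f v"
      have "\<bar>f (\<lambda>x. k * v x)\<bar> \<le> ?D"
        using True N_scale[OF v, of k] by (intro unit scale[OF v]) simp
      moreover have "f (\<lambda>x. k * v x) = ?D + 1"
        using \<open>f v \<noteq> 0\<close> unfolding scale(1)[OF v] by (simp add: k_def)
      ultimately show False by simp
    qed
    with True show ?thesis by simp
  next
    case False
    then have pos: "0 < ?N UNIV v" by (simp add: sobolev_norm_def less_le)
    define k where "k = 1 / ?N UNIV v"
    have "\<bar>f (\<lambda>x. k * v x)\<bar> \<le> ?D"
    proof (intro unit scale(2)[OF v])
      show "?N UNIV (\<lambda>x. k * v x) \<le> 1"
        unfolding N_scale[OF v] using pos by (simp add: k_def)
    qed
    then have "\<bar>k * f v\<bar> \<le> ?D"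
      unfolding scale(1)[OF v] .
    with pos show ?thesis
      by (simp add: k_def abs_mult field_simps)
  qed
qed

theorem theorem3p4:
  fixes a b \<beta> lam :: real
  assumes "a < b" and "0 < \<beta>" and "\<beta> < 2" and "0 \<le> lam"
  shows "(\<forall>f \<in> sobolev_dual (\<beta> / 2) {a<..<b}.
            \<exists>p. weak_solution \<beta> lam {a<..<b} f p \<and>
                (\<forall>q. weak_solution \<beta> lam {a<..<b} f q \<longrightarrow> (AE x in lborel. q x = p x))) \<and>
         (\<exists>C>0. \<forall>f \<in> sobolev_dual (\<beta> / 2) {a<..<b}. \<forall>p. weak_solution \<beta> lam {a<..<b} f p \<longrightarrow>
            sobolev_norm (\<beta> / 2) UNIV p \<le> C * sobolev_dual_norm (\<beta> / 2) {a<..<b} f)"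
proof -
  let ?\<Omega> = "{a<..<b}" and ?H = "sobolev_space (\<beta> / 2) UNIV" and ?B = "B_form \<beta> lam"
  let ?V = "sobolev_tilde_zero (\<beta> / 2) ?\<Omega>" and ?N = "sobolev_norm (\<beta> / 2) UNIV"
  let ?sq = "sobolev_sq (\<beta> / 2) UNIV" and ?D = "sobolev_dual_norm (\<beta> / 2) ?\<Omega>"
  define c where "c = c_const \<beta> lam / 2"
  have c: "0 < c" using assms by (simp add: c_def c_const_pos)
  obtain C0 where C0: "0 < C0" "\<And>w. w \<in> ?V \<Longrightarrow> ?sq w \<le> ennreal C0 * energy \<beta> lam w"
    using sobolev_tilde_zero_coercive[of a b \<beta> lam] assms by blast
  define C where "C = C0 / c"
  have C: "0 < C" using C0 c by (simp add: C_def)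
  have VH: "w \<in> ?H" if "w \<in> ?V" for w
    using that by (simp add: sobolev_tilde_zero_iff)
  have V_meas: "w \<in> borel_measurable borel" if "w \<in> ?V" for w
    using VH[OF that] by (simp add: sobolev_space_UNIV_iff)
  have diff: "(\<lambda>x. u x - v x) \<in> ?V" if "u \<in> ?V" "v \<in> ?V" for u v
    using sobolev_tilde_zero_linear[OF that, of "-1"] by simp
  have integrable: "integrable (lborel \<Otimes>\<^sub>M lborel) (energy_density \<beta> lam u v)" if "u \<in> ?H" "v \<in> ?H" for u v
    using that assms by (intro sobolev_space_energy_density_integrable) simp_all
  have B_lin: "?B (\<lambda>x. u x + t * v x) w = ?B u w + t * ?B v w" if "u \<in> ?V" "v \<in> ?V" "w \<in> ?V" for u v w t
    using that by (intro B_form_linear integrable VH)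
  have energy_B: "ennreal c * energy \<beta> lam w = ennreal (?B w w)" and B_nonneg: "0 \<le> ?B w w" if "w \<in> ?V" for w
  proof -
    have int: "integrable (lborel \<Otimes>\<^sub>M lborel) (energy_density \<beta> lam w w)"
      using that by (intro integrable VH)
    show "0 \<le> ?B w w"
      unfolding B_form_eq_pair_integral[OF int] c_def[symmetric] using c
      by (intro mult_nonneg_nonneg integral_nonneg) auto
    then show "ennreal c * energy \<beta> lam w = ennreal (?B w w)"
      using c energy_eq_B_form[OF int] by (simp add: c_def flip: ennreal_mult)
  qed
  have coercive: "?sq w \<le> ennreal (C * ?B w w)" if "w \<in> ?V" for w
  proof -
    have "?sq w \<le> ennreal (C * c) * energy \<beta> lam w"
      using C0(2)[OF that] c by (simp add: C_def)
    also have "\<dots> = ennreal C * (ennreal c * energy \<beta> lam w)"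
      using C c by (simp add: ennreal_mult mult.assoc)
    finally show ?thesis
      using C B_nonneg[OF that] by (simp add: energy_B[OF that] ennreal_mult)
  qed
  have norm_coercive: "(?N w)\<^sup>2 \<le> C * ?B w w" if "w \<in> ?V" for w
  proof -
    have "ennreal ((?N w)\<^sup>2) = ?sq w"
      using VH[OF that] by (intro sobolev_norm_power2) (simp add: sobolev_space_UNIV_iff)
    with coercive[OF that] have "ennreal ((?N w)\<^sup>2) \<le> ennreal (C * ?B w w)" by simp
    with B_nonneg[OF that] C show ?thesis by (subst (asm) ennreal_le_iff) simp_all
  qed
  have complete: "\<exists>w\<in>?V. (\<lambda>n. ?B (\<lambda>x. u n x - w x) (\<lambda>x. u n x - w x)) \<longlonglongrightarrow> 0"
    if u: "\<And>n. u n \<in> ?V"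
      and cauchy: "\<And>n m. n \<le> m \<Longrightarrow> ?B (\<lambda>x. u m x - u n x) (\<lambda>x. u m x - u n x) \<le> (1/4) ^ n"
    for u :: "nat \<Rightarrow> real \<Rightarrow> real"
  proof -
    have sq: "?sq (\<lambda>x. u m x - u n x) \<le> ennreal (C * (1/4) ^ n)" if "n \<le> m" for n m
    proof -
      have "?sq (\<lambda>x. u m x - u n x) \<le> ennreal (C * ?B (\<lambda>x. u m x - u n x) (\<lambda>x. u m x - u n x))"
        using u by (intro coercive diff)
      also have "\<dots> \<le> ennreal (C * (1/4) ^ n)"
        using C by (intro ennreal_leI mult_left_mono cauchy that) simp
      finally show ?thesis .
    qed
    obtain w where w: "w \<in> borel_measurable borel"
      and lim: "\<And>n. ?sq (\<lambda>x. u n x - w x) \<le> ennreal (2 * C * (1/4) ^ n)"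
      using rapidly_cauchy_sobolev_limit[OF V_meas[OF u] less_imp_le[OF C] sq] by blast
    have to_0: "(\<lambda>n. 2 * C * (1/4) ^ n) \<longlonglongrightarrow> 0"
      by (intro tendsto_mult_right_zero LIMSEQ_power_zero) simp
    then have "(\<lambda>n. ennreal (2 * C * (1/4) ^ n)) \<longlonglongrightarrow> 0"
      using tendsto_ennrealI by force
    then have "(\<lambda>n. ?sq (\<lambda>x. u n x - w x)) \<longlonglongrightarrow> 0"
      by (rule tendsto_sandwich[OF _ _ tendsto_const, rotated 2]) (simp_all add: lim)
    then have wV: "w \<in> ?V"
      by (rule sobolev_tilde_zero_closed[OF u w])
    have "?B (\<lambda>x. u n x - w x) (\<lambda>x. u n x - w x) \<le> c * (2 * C * (1/4) ^ n)" for n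
    proof -
      let ?e = "\<lambda>x. u n x - w x"
      have e: "?e \<in> ?V" using u wV by (intro diff)
      have "ennreal (?B ?e ?e) = ennreal c * energy \<beta> lam ?e"
        by (rule energy_B[OF e, symmetric])
      also have "energy \<beta> lam ?e \<le> energy \<beta> 0 ?e"
        using V_meas[OF e] \<open>0 \<le> lam\<close> by (rule energy_le_energy_0)
      also have "energy \<beta> 0 ?e \<le> ?sq ?e"
        by (simp add: sobolev_sq_eq_mass_plus_energy[OF V_meas[OF e]])
      also have "?sq ?e \<le> ennreal (2 * C * (1/4) ^ n)" by (rule lim)
      also have "ennreal c * ennreal (2 * C * (1/4) ^ n) = ennreal (c * (2 * C * (1/4) ^ n))"
        using c C by (simp flip: ennreal_mult)
      finally show ?thesis
        using c C by (simp add: mult_left_mono)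
    qed
    then have "\<forall>\<^sub>F n in sequentially.
        norm (?B (\<lambda>x. u n x - w x) (\<lambda>x. u n x - w x)) \<le> c * (2 * C * (1/4) ^ n)"
      using B_nonneg[OF diff[OF u wV]] by (intro always_eventually) simp
    then have "(\<lambda>n. ?B (\<lambda>x. u n x - w x) (\<lambda>x. u n x - w x)) \<longlonglongrightarrow> 0"
      using tendsto_mult_right_zero[OF to_0, of c] by (rule Lim_null_comparison)
    with wV show ?thesis by blast
  qed
  have bound: "\<bar>f v\<bar> \<le> ?D f * ?N v" if "f \<in> sobolev_dual (\<beta> / 2) ?\<Omega>" "v \<in> ?V" for f v
    using that by (intro sobolev_dual_norm_bound) simp_all
  have D_nonneg: "0 \<le> ?D f" if f: "f \<in> sobolev_dual (\<beta> / 2) ?\<Omega>" for f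
  proof -
    have "(\<lambda>x. 0) \<in> {v \<in> sobolev_zero (\<beta> / 2) ?\<Omega>. sobolev_norm (\<beta> / 2) ?\<Omega> v \<le> 1}"
      using zero_in_sobolev_tilde_zero[of "\<beta> / 2" ?\<Omega>] sobolev_tilde_zero_subset[of ?\<Omega> "\<beta> / 2"]
      by (auto simp: sobolev_norm_def sobolev_sq_def)
    from cSUP_upper[OF this sobolev_dual_bdd_above[OF f]] show ?thesis
      unfolding sobolev_dual_norm_def by (rule order_trans[OF abs_ge_zero])
  qed
  have existence: "\<exists>p\<in>?V. \<forall>v\<in>?V. ?B p v = f v" if f: "f \<in> sobolev_dual (\<beta> / 2) ?\<Omega>" for f
  proof (rule riesz_representation_of_complete_form[where K = "(?D f)\<^sup>2 * C"])
    show "?V \<noteq> {}" using zero_in_sobolev_tilde_zero by blast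
    show "f (\<lambda>x. u x + t * v x) = f u + t * f v" if "u \<in> ?V" "v \<in> ?V" for u v t
    proof -
      have "(\<lambda>x. t * v x) \<in> ?V"
        using sobolev_tilde_zero_linear[OF zero_in_sobolev_tilde_zero that(2), of t] by simp
      then show ?thesis
        using f that sobolev_tilde_zero_subset[of ?\<Omega> "\<beta> / 2"] by (simp add: sobolev_dual_def subset_iff)
    qed
    show "(f v)\<^sup>2 \<le> (?D f)\<^sup>2 * C * ?B v v" if "v \<in> ?V" for v
    proof -
      have "(f v)\<^sup>2 \<le> (?D f * ?N v)\<^sup>2"
        using bound[OF f that] by (rule power2_le_iff_abs_le[THEN iffD2, rotated])
          (simp add: D_nonneg[OF f] sobolev_norm_def)
      also have "\<dots> \<le> (?D f)\<^sup>2 * (C * ?B v v)"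
        unfolding power_mult_distrib by (intro mult_left_mono norm_coercive that) simp
      finally show ?thesis by (simp add: mult.assoc)
    qed
    show "0 \<le> (?D f)\<^sup>2 * C" using C by simp
  qed (use B_lin B_nonneg complete in \<open>auto intro: sobolev_tilde_zero_linear B_form_sym\<close>)
  have unique: "AE x in lborel. q x = p x"
    if "weak_solution \<beta> lam ?\<Omega> f p" "weak_solution \<beta> lam ?\<Omega> f q" for f p q
  proof -
    let ?e = "\<lambda>x. q x - p x"
    have p: "p \<in> ?V" "\<And>v. v \<in> ?V \<Longrightarrow> ?B p v = f v" and q: "q \<in> ?V" "\<And>v. v \<in> ?V \<Longrightarrow> ?B q v = f v"
      using that by (auto simp: weak_solution_def)
    have e: "?e \<in> ?V" using p(1) q(1) by (intro diff)
    have "?B ?e ?e = ?B q ?e - ?B p ?e"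
      using B_lin[OF q(1) p(1) e, of "-1"] by simp
    then have "?B ?e ?e = 0" using p q e by simp
    with coercive[OF e] have "?sq ?e = 0" by simp
    then have "mass ?e = 0"
      by (simp add: sobolev_sq_eq_mass_plus_energy[OF V_meas[OF e]])
    then have "AE x in lborel. ennreal ((?e x)\<^sup>2) = 0"
      unfolding mass_def using V_meas[OF e] by (subst (asm) nn_integral_0_iff_AE) auto
    then show ?thesis by eventually_elim simp
  qed
  have stable: "?N p \<le> C * ?D f"
    if f: "f \<in> sobolev_dual (\<beta> / 2) ?\<Omega>" and p: "weak_solution \<beta> lam ?\<Omega> f p" for f p
  proof -
    have pV: "p \<in> ?V" and "?B p p = f p" using p by (auto simp: weak_solution_def)
    then have "?N p * ?N p \<le> C * f p"
      using norm_coercive[OF pV] by (simp add: power2_eq_square)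
    also have "\<dots> \<le> C * (?D f * ?N p)"
      using bound[OF f pV] C by (intro mult_left_mono) simp_all
    finally have "?N p * ?N p \<le> (C * ?D f) * ?N p" by (simp add: mult.assoc)
    moreover have "0 \<le> ?N p" by (simp add: sobolev_norm_def)
    ultimately show ?thesis
      using C D_nonneg[OF f] by (cases "?N p = 0") (auto simp: mult_le_cancel_right)
  qed
  show ?thesis
  proof (intro conjI ballI exI[of _ C] allI impI)
    fix f assume f: "f \<in> sobolev_dual (\<beta> / 2) ?\<Omega>"
    from existence[OF f] obtain p where "weak_solution \<beta> lam ?\<Omega> f p"
      by (auto simp: weak_solution_def)
    with unique show "\<exists>p. weak_solution \<beta> lam ?\<Omega> f p \<and>
        (\<forall>q. weak_solution \<beta> lam ?\<Omega> f q \<longrightarrow> (AE x in lborel. q x = p x))"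
      by blast
  qed (use C stable in auto)
qed

end
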